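(* Let $A\in\mathbb{R}^{n\times n}$ be a symmetric matrix, let $q$ be the number of negative eigenvalues of $A$, and let $p\le q$. Consider the iteration on $X^{(t)}\in\mathbb{R}^{n\times p}$ with stepsize $\alpha>0$ $$X^{(t+1)}=X^{(t)}-\alpha\left(AX^{(t)}+X^{(t)}\,\mathrm{triu}\!\left((X^{(t)})^\top X^{(t)}\right)\right).$$ All fixed points of this iteration are of the form $X=U_q\sqrt{-\Lambda_q}\,P\,S$, where $\sqrt{\cdot}$ is applied entrywise, $P\in\mathbb{R}^{q\times p}$ is the first $p$ columns of an arbitrary $q\times q$ permutation matrix, and $S\in\mathbb{R}^{p\times p}$ is a diagonal matrix with diagonal entries being $0$ or $\pm1$. Within these points, all stable fixed points are of the form $X=U_p\sqrt{-\Lambda_p}\,D$, where $D\in\mathbb{R}^{p\times p}$ is a diagonal matrix with diagonal entries being $\pm1$. Others are unstable fixed points.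
   Context: $\mathrm{triu}(M)$ denotes the upper triangular part (including the diagonal) of a square matrix $M$. $\Lambda$ is the diagonal matrix whose diagonal entries are the eigenvalues $\lambda_1,\dots,\lambda_n$ of $A$ in increasing order, and $\Lambda_i$ is its leading $i\times i$ principal submatrix. $U$ is an orthogonal matrix satisfying $U^\top AU=\Lambda$, and $U_i$ is the matrix of its first $i$ columns. Write $g_1(X)=AX+X\,\mathrm{triu}(X^\top X)$; fixed points are the matrices $X$ with $g_1(X)=0$. Stability of a fixed point $X$ is determined by the spectrum of the Jacobian $\mathrm{D}g_1(X)$, unfolded as an $np\times np$ matrix: $X$ is stable when all eigenvalues of $\mathrm{D}g_1(X)$ are strictly positive, and unstable when $\mathrm{D}g_1(X)$ has a negative eigenvalue.
   Formalization: For repeated eigenvalues U may depend on X in the fixed-point form and in "others are unstable"; for a given U these need distinct negative eigenvalues, resp. λ_1<…<λ_p<λ_{p+1} (last only if p<n), which also gives the converse "stable form implies stable". *)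

theory Defs
  imports "HOL-Analysis.Derivative" "Jordan_Normal_Form.Char_Poly"
begin

unbundle no vec_syntax  \<comment> \<open>\<open>$\<close> is component selection of Jordan_Normal_Form vectors\<close>

definition triu :: "real mat \<Rightarrow> real mat" where
  "triu M = mat (dim_row M) (dim_col M) (\<lambda>(i, j). if i \<le> j then M $$ (i, j) else 0)"

definition first_cols :: "nat \<Rightarrow> real mat \<Rightarrow> real mat" where
  "first_cols k M = mat (dim_row M) k (\<lambda>(i, j). M $$ (i, j))"

definition leading_principal :: "nat \<Rightarrow> real mat \<Rightarrow> real mat" where
  "leading_principal k M = mat k k (\<lambda>(i, j). M $$ (i, j))"

definition permutation_matrix :: "nat \<Rightarrow> real mat \<Rightarrow> bool" where
  "permutation_matrix k Q \<longleftrightarrow>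
    (\<exists>\<sigma>. \<sigma> permutes {..<k} \<and> Q = mat k k (\<lambda>(i, j). if i = \<sigma> j then 1 else 0))"

definition diagonal_with_entries :: "nat \<Rightarrow> real set \<Rightarrow> real mat \<Rightarrow> bool" where
  "diagonal_with_entries k E S \<longleftrightarrow>
    S \<in> carrier_mat k k \<and> diagonal_mat S \<and> (\<forall>i<k. S $$ (i, i) \<in> E)"


text \<open>Eigenvalues are counted with algebraic multiplicity. For a symmetric real \<open>n \<times> n\<close> matrix
  all roots of the characteristic polynomial are real, so the list has length \<open>n\<close>.\<close>

definition eigs :: "real mat \<Rightarrow> real list" where
  "eigs A = sorted_list_of_multiset (proots (char_poly A))"

definition num_neg_eigs :: "real mat \<Rightarrow> nat" where
  "num_neg_eigs A = length (filter (\<lambda>x. x < 0) (eigs A))"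

definition Lambda :: "real mat \<Rightarrow> real mat" where
  "Lambda A = mat_diag (dim_row A) (\<lambda>i. eigs A ! i)"

text \<open>The library's \<open>orthogonal_mat\<close> does not require normalised columns.\<close>

definition diagonalizer :: "real mat \<Rightarrow> real mat \<Rightarrow> bool" where
  "diagonalizer A U \<longleftrightarrow>
    U \<in> carrier_mat (dim_row A) (dim_row A) \<and>
    U\<^sup>T * U = 1\<^sub>m (dim_row A) \<and> U\<^sup>T * A * U = Lambda A"


definition g1 :: "real mat \<Rightarrow> real mat \<Rightarrow> real mat" where
  "g1 A X = A * X + X * triu (X\<^sup>T * X)"

definition iteration_step :: "real \<Rightarrow> real mat \<Rightarrow> real mat \<Rightarrow> real mat" where
  "iteration_step \<alpha> A X = X - \<alpha> \<cdot>\<^sub>m (A * X + X * triu (X\<^sup>T * X))"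

definition fixed_point :: "real \<Rightarrow> real mat \<Rightarrow> real mat \<Rightarrow> bool" where
  "fixed_point \<alpha> A X \<longleftrightarrow> iteration_step \<alpha> A X = X"

lemma fixed_point_iff_g1_zero:
  assumes "A \<in> carrier_mat n n" "X \<in> carrier_mat n p" "\<alpha> > 0"
  shows "fixed_point \<alpha> A X \<longleftrightarrow> g1 A X = 0\<^sub>m n p"
proof -
  have G: "g1 A X \<in> carrier_mat n p"
    unfolding g1_def triu_def using assms(1,2) by auto
  have step: "iteration_step \<alpha> A X = X - \<alpha> \<cdot>\<^sub>m g1 A X"
    by (simp add: iteration_step_def g1_def)
  show ?thesis
  proof
    assume "fixed_point \<alpha> A X"
    then have eq: "X - \<alpha> \<cdot>\<^sub>m g1 A X = X"
      by (simp only: fixed_point_def step)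
    show "g1 A X = 0\<^sub>m n p"
    proof (rule eq_matI)
      fix i j assume "i < dim_row (0\<^sub>m n p :: real mat)" "j < dim_col (0\<^sub>m n p :: real mat)"
      then have ij: "i < n" "j < p" by auto
      have "(X - \<alpha> \<cdot>\<^sub>m g1 A X) $$ (i, j) = X $$ (i, j) - \<alpha> * g1 A X $$ (i, j)"
        using assms(2) G ij by simp
      with eq have "\<alpha> * g1 A X $$ (i, j) = 0" by simp
      with assms(3) ij show "g1 A X $$ (i, j) = 0\<^sub>m n p $$ (i, j)" by simp
    qed (use G in auto)
  next
    assume g: "g1 A X = 0\<^sub>m n p"
    have "X - \<alpha> \<cdot>\<^sub>m 0\<^sub>m n p = X"
      by (rule eq_matI) (use assms(2) in auto)
    then show "fixed_point \<alpha> A X"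
      by (simp only: fixed_point_def step g)
  qed
qed


text \<open>Columnwise unfolding of an \<open>n \<times> p\<close> matrix into a vector of length \<open>n * p\<close>, and its
  inverse.\<close>

definition vectorize :: "real mat \<Rightarrow> real vec" where
  "vectorize M = vec (dim_row M * dim_col M) (\<lambda>k. M $$ (k mod dim_row M, k div dim_row M))"

definition unvectorize :: "nat \<Rightarrow> nat \<Rightarrow> real vec \<Rightarrow> real mat" where
  "unvectorize n p v = mat n p (\<lambda>(i, j). v $ (i + j * n))"

text \<open>Matrix of partial derivatives. The function differentiated below is polynomial, so this is
  the matrix of its total derivative.\<close>

definition jacobian_mat :: "(real vec \<Rightarrow> real vec) \<Rightarrow> real vec \<Rightarrow> real mat" where
  "jacobian_mat F x = mat (dim_vec (F x)) (dim_vec x)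
    (\<lambda>(i, j). deriv (\<lambda>t. F (x + t \<cdot>\<^sub>v unit_vec (dim_vec x) j) $ i) 0)"

definition Dg1 :: "real mat \<Rightarrow> real mat \<Rightarrow> real mat" where
  "Dg1 A X = jacobian_mat
    (\<lambda>v. vectorize (g1 A (unvectorize (dim_row X) (dim_col X) v))) (vectorize X)"

text \<open>\<open>Dg1 A X\<close> need not be symmetric, so its spectrum is taken over the complex numbers;
  strictly positive means real and positive.\<close>

definition stable_fixed_point :: "real \<Rightarrow> real mat \<Rightarrow> real mat \<Rightarrow> bool" where
  "stable_fixed_point \<alpha> A X \<longleftrightarrow> fixed_point \<alpha> A X \<and>
    (\<forall>z. eigenvalue (map_mat complex_of_real (Dg1 A X)) z \<longrightarrow> z \<in> \<real> \<and> Re z > 0)"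

definition unstable_fixed_point :: "real \<Rightarrow> real mat \<Rightarrow> real mat \<Rightarrow> bool" where
  "unstable_fixed_point \<alpha> A X \<longleftrightarrow> fixed_point \<alpha> A X \<and> (\<exists>x<0. eigenvalue (Dg1 A X) x)"


definition fixed_form :: "real mat \<Rightarrow> nat \<Rightarrow> real mat \<Rightarrow> real mat \<Rightarrow> bool" where
  "fixed_form A p U X \<longleftrightarrow> (let q = num_neg_eigs A in
    \<exists>Q S. permutation_matrix q Q \<and> diagonal_with_entries p {0, 1, -1} S \<and>
      X = first_cols q U * map_mat sqrt (- leading_principal q (Lambda A)) * first_cols p Q * S)"

definition stable_form :: "real mat \<Rightarrow> nat \<Rightarrow> real mat \<Rightarrow> real mat \<Rightarrow> bool" where
  "stable_form A p U X \<longleftrightarrow>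
    (\<exists>D. diagonal_with_entries p {1, -1} D \<and>
      X = first_cols p U * map_mat sqrt (- leading_principal p (Lambda A)) * D)"

end

theory Submission
  imports Defs
begin

text \<open>Column \<open>j\<close> of \<open>g1 A X = 0\<close> involves only columns \<open>i \<le> j\<close>, and induction on \<open>j\<close> shows that the
  columns of a fixed point are orthogonal with \<open>A x\<^sub>j = - |x\<^sub>j|\<^sup>2 x\<^sub>j\<close>. Householder reflections inside
  the eigenspaces turn any diagonalizer into one containing the normalised nonzero columns.

  For the same reason the Jacobian at a fixed point is block lower triangular. Hence an eigenvector
  of eigenvalue \<open>\<kappa>\<close> orthogonal to \<open>x\<^sub>0, \<dots>, x\<^sub>j\<close> gives the eigenvalue \<open>\<kappa> + |x\<^sub>j|\<^sup>2\<close> of the Jacobian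
  whenever this number is nonpositive. Without negative eigenvalues, each \<open>- |x\<^sub>j|\<^sup>2\<close> must
  therefore be the smallest eigenvalue not yet used, which forces \<open>- |x\<^sub>j|\<^sup>2 = \<lambda>\<^sub>j\<close>. Conversely, at such
  a point the diagonal blocks have the eigenvalues \<open>- \<lambda>\<^sub>j\<close>, \<open>- 2 \<lambda>\<^sub>j\<close> and \<open>\<lambda>\<^sub>k - \<lambda>\<^sub>j\<close> for \<open>k > j\<close>.\<close>

section \<open>Orthonormal eigenbases\<close>

text \<open>Repeated eigenvalues shape the whole proof. For \<open>A = - I\<close> and
  \<open>p = 1\<close> every unit vector is a fixed point, so the columns of a fixed point need not
  be multiples of columns of the given \<open>U\<close>. A diagonalizer adapted to the point has to
  be produced, and the way back to \<open>U\<close> is available, up to signs, only at simple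
  eigenvalues. Ties also create points that are neither stable nor unstable: if
  \<open>l k = l j\<close> with \<open>j < p\<close> and \<open>j < k\<close>, a point in
  \<open>stable_form\<close> has the Jacobian eigenvalue 0. Hence a fixed point is unstable exactly
  when no diagonalizer puts it in \<open>stable_form\<close>, whereas stability itself excludes such
  ties and thereby reaches \<open>U\<close>.\<close>

text \<open>Vectors are functions of which only the values below \<open>n\<close> matter, and a family of columns is
  indexed by the column first. The form \<open>ip\<close> is bilinear, without conjugation, also over the
  complex numbers.\<close>

definition ip :: "nat \<Rightarrow> (nat \<Rightarrow> 'a::comm_ring_1) \<Rightarrow> (nat \<Rightarrow> 'a) \<Rightarrow> 'a" where
  "ip n x y = (\<Sum>a<n. x a * y a)"

definition mv :: "nat \<Rightarrow> (nat \<Rightarrow> nat \<Rightarrow> 'a::comm_ring_1) \<Rightarrow> (nat \<Rightarrow> 'a) \<Rightarrow> nat \<Rightarrow> 'a" where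
  "mv n A x a = (\<Sum>b<n. A a b * x b)"

lemma ip_commute: "ip n x y = ip n y x"
  by (simp add: ip_def mult.commute)

lemma ip_cong: "(\<And>a. a < n \<Longrightarrow> x a = x' a) \<Longrightarrow> (\<And>a. a < n \<Longrightarrow> y a = y' a) \<Longrightarrow> ip n x y = ip n x' y'"
  by (simp add: ip_def)

lemma mv_cong: "(\<And>a. a < n \<Longrightarrow> x a = x' a) \<Longrightarrow> mv n A x b = mv n A x' b"
  by (simp add: mv_def)

lemma ip_add_left: "ip n (\<lambda>a. x a + y a) z = ip n x z + ip n y z"
  and ip_add_right: "ip n z (\<lambda>a. x a + y a) = ip n z x + ip n z y"
  and ip_diff_left: "ip n (\<lambda>a. x a - y a) z = ip n x z - ip n y z"
  and ip_diff_right: "ip n z (\<lambda>a. x a - y a) = ip n z x - ip n z y"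
  and ip_scale_left: "ip n (\<lambda>a. c * x a) z = c * ip n x z"
  and ip_scale_right: "ip n z (\<lambda>a. c * x a) = c * ip n z x"
  by (simp_all add: ip_def algebra_simps sum.distrib sum_subtractf sum_distrib_left)

lemma ip_zero_left [simp]: "ip n (\<lambda>a. 0) z = 0"
  and ip_zero_right [simp]: "ip n z (\<lambda>a. 0) = 0"
  by (simp_all add: ip_def)

lemma ip_sum_left: "ip n (\<lambda>a. \<Sum>i\<in>I. f i a) z = (\<Sum>i\<in>I. ip n (f i) z)"
  unfolding ip_def sum_distrib_right by (rule sum.swap)

lemma ip_sum_right: "ip n z (\<lambda>a. \<Sum>i\<in>I. f i a) = (\<Sum>i\<in>I. ip n z (f i))"
  by (simp add: ip_commute [of n z] ip_sum_left)

lemmas ip_linear = ip_add_left ip_add_right ip_diff_left ip_diff_right ip_scale_left ip_scale_right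

lemma mv_diff: "mv n A (\<lambda>a. x a - y a) b = mv n A x b - mv n A y b"
  and mv_scale: "mv n A (\<lambda>a. c * x a) b = c * mv n A x b"
  by (simp_all add: mv_def algebra_simps sum_subtractf sum_distrib_left)

lemma ip_mv_symmetric:
  assumes "\<And>a b. a < n \<Longrightarrow> b < n \<Longrightarrow> A a b = A b a"
  shows "ip n (mv n A x) y = ip n x (mv n A y)"
proof -
  have "ip n (mv n A x) y = (\<Sum>a<n. \<Sum>b<n. A a b * x b * y a)"
    by (simp add: ip_def mv_def sum_distrib_right)
  also have "\<dots> = (\<Sum>b<n. \<Sum>a<n. A a b * x b * y a)"
    by (rule sum.swap)
  also have "\<dots> = ip n x (mv n A y)"
    unfolding ip_def mv_def sum_distrib_left
    by (intro sum.cong refl) (simp add: assms)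
  finally show ?thesis .
qed

lemma ip_self_nonneg: "ip n x x \<ge> (0::real)"
  by (simp add: ip_def sum_nonneg)

lemma ip_self_eq_0_iff: "ip n x x = (0::real) \<longleftrightarrow> (\<forall>a<n. x a = 0)"
  by (auto simp: ip_def sum_nonneg_eq_0_iff)

lemma ip_self_0_ip: "ip n x x = (0::real) \<Longrightarrow> ip n x y = 0" "ip n x x = (0::real) \<Longrightarrow> ip n y x = 0"
  unfolding ip_self_eq_0_iff by (simp_all add: ip_def)

lemma eigenvectors_orthogonal:
  fixes A :: "nat \<Rightarrow> nat \<Rightarrow> 'a::idom"
  assumes "\<And>a b. a < n \<Longrightarrow> b < n \<Longrightarrow> A a b = A b a"
    and x: "\<And>a. a < n \<Longrightarrow> mv n A x a = \<kappa> * x a"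
    and y: "\<And>a. a < n \<Longrightarrow> mv n A y a = \<mu> * y a"
    and "\<kappa> \<noteq> \<mu>"
  shows "ip n x y = 0"
proof -
  have "ip n (mv n A x) y = \<kappa> * ip n x y"
    unfolding ip_scale_left [symmetric] by (rule ip_cong) (simp_all add: x)
  moreover have "ip n x (mv n A y) = \<mu> * ip n x y"
    unfolding ip_scale_right [symmetric] by (rule ip_cong) (simp_all add: y)
  ultimately have "\<kappa> * ip n x y = \<mu> * ip n x y"
    using ip_mv_symmetric [of n A x y, OF assms(1)] by metis
  with \<open>\<kappa> \<noteq> \<mu>\<close> show ?thesis by (metis mult_right_cancel)
qed

definition eigenbasis :: "nat \<Rightarrow> (nat \<Rightarrow> nat \<Rightarrow> 'a::comm_ring_1) \<Rightarrow> (nat \<Rightarrow> 'a) \<Rightarrow> (nat \<Rightarrow> nat \<Rightarrow> 'a) \<Rightarrow> bool" where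
  "eigenbasis n A l V \<longleftrightarrow>
    (\<forall>k<n. \<forall>a<n. mv n A (V k) a = l k * V k a) \<and>
    (\<forall>k<n. \<forall>m<n. ip n (V k) (V m) = (if k = m then 1 else 0))"

text \<open>For a square matrix a left inverse is also a right inverse, so orthonormal columns give
  the completeness relation \<open>sum_k V k a * V k b = delta_ab\<close>. Positivity does not
  enter, which makes the expansion available for the complexified basis with its bilinear
  form.\<close>

lemma eigenbasis_expansion:
  fixes V :: "nat \<Rightarrow> nat \<Rightarrow> 'a::field"
  assumes V: "eigenbasis n A l V" and a: "a < n"
  shows "u a = (\<Sum>k<n. ip n (V k) u * V k a)"
proof -
  define M where "M = mat n n (\<lambda>(a, k). V k a)"
  have M: "M \<in> carrier_mat n n" by (simp add: M_def)
  have "M\<^sup>T * M = 1\<^sub>m n"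
    by (rule eq_matI)
      (use V in \<open>auto simp: M_def scalar_prod_def eigenbasis_def ip_def atLeast0LessThan\<close>)
  then have "M * M\<^sup>T = 1\<^sub>m n"
    by (rule mat_mult_left_right_inverse [rotated 2]) (use M in auto)
  then have "\<And>b. b < n \<Longrightarrow> (M * M\<^sup>T) $$ (a, b) = (if a = b then 1 else 0)"
    using a by simp
  then have *: "(\<Sum>k<n. V k a * V k b) = (if a = b then 1 else 0)" if "b < n" for b
    using a that by (simp add: M_def scalar_prod_def atLeast0LessThan)
  have "(\<Sum>k<n. ip n (V k) u * V k a) = (\<Sum>k<n. \<Sum>b<n. V k a * V k b * u b)"
    by (simp add: ip_def sum_distrib_left mult.commute mult.left_commute)
  also have "\<dots> = (\<Sum>b<n. (\<Sum>k<n. V k a * V k b) * u b)"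
    unfolding sum_distrib_right by (rule sum.swap)
  also have "\<dots> = (\<Sum>b<n. if b = a then u b else 0)"
    by (intro sum.cong refl) (simp add: *)
  also have "\<dots> = u a" using a by simp
  finally show ?thesis by simp
qed

corollary eigenbasis_coefficient_nonzero:
  fixes V :: "nat \<Rightarrow> nat \<Rightarrow> 'a::field"
  assumes "eigenbasis n A l V" "a < n" "u a \<noteq> 0"
  obtains k where "k < n" "ip n (V k) u \<noteq> 0"
proof -
  have "\<exists>k<n. ip n (V k) u \<noteq> 0"
  proof (rule ccontr)
    assume "\<not> ?thesis"
    then have "u a = 0"
      using eigenbasis_expansion [OF assms(1,2), of u] by simp
    with assms(3) show False by simp
  qed
  with that show ?thesis by blast
qed

lemma eigenbasis_replace:
  fixes A :: "nat \<Rightarrow> nat \<Rightarrow> real"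
  assumes sym: "\<And>a b. a < n \<Longrightarrow> b < n \<Longrightarrow> A a b = A b a"
    and V: "eigenbasis n A l V" and k: "k < n"
    and u1: "ip n u u = 1" and Au: "\<And>a. a < n \<Longrightarrow> mv n A u a = l k * u a"
  obtains W where "eigenbasis n A l W" "\<And>a. a < n \<Longrightarrow> W k a = u a"
    "\<And>m a. m < n \<Longrightarrow> m \<noteq> k \<Longrightarrow> ip n (V m) u = 0 \<Longrightarrow> a < n \<Longrightarrow> W m a = V m a"
proof -
  define w where "w = (\<lambda>a. u a - V k a)"
  define N where "N = ip n w w"
  have AV: "\<And>m a. m < n \<Longrightarrow> a < n \<Longrightarrow> mv n A (V m) a = l m * V m a"
    and VV: "\<And>m r. m < n \<Longrightarrow> r < n \<Longrightarrow> ip n (V m) (V r) = (if m = r then 1 else 0)"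
    using V by (auto simp: eigenbasis_def)
  have N: "N = 2 - 2 * ip n (V k) u"
    unfolding N_def w_def ip_linear using u1 VV [OF k k]
    by (simp add: ip_commute [of n u "V k"])
  show thesis
  proof (cases "N = 0")
    case True
    then have "\<And>a. a < n \<Longrightarrow> u a = V k a"
      unfolding N_def ip_self_eq_0_iff w_def by simp
    with V show thesis by (intro that [of V]) auto
  next
    case False
    \<comment> \<open>Reflect the basis in the hyperplane orthogonal to \<open>w\<close>, which exchanges \<open>V k\<close> and \<open>u\<close>.
      Since \<open>w\<close> lies in the eigenspace of \<open>l k\<close>, the reflection commutes with \<open>A\<close>.\<close>
    define c where "c = (\<lambda>m. 2 * ip n (V m) w / N)"
    define W where "W = (\<lambda>m a. V m a - c m * w a)"
    have Aw: "mv n A w a = l k * w a" if "a < n" for a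
      unfolding w_def using that k by (simp add: mv_diff Au AV algebra_simps)
    \<comment> \<open>Either \<open>V m\<close> has the eigenvalue \<open>l k\<close>, or it is
      orthogonal to \<open>w\<close> and the reflection leaves it alone.\<close>
    have cl: "c m * l m = c m * l k" if m: "m < n" for m
    proof (cases "l m = l k")
      case False
      have "ip n (V m) w = 0"
        by (rule eigenvectors_orthogonal [of n A _ "l m" _ "l k"])
          (use sym AV [OF m] Aw False in auto)
      then show ?thesis by (simp add: c_def)
    qed simp
    have "mv n A (W m) a = l m * W m a" if "m < n" "a < n" for m a
    proof -
      have "mv n A (W m) a = l m * V m a - (c m * l k) * w a"
        unfolding W_def mv_diff mv_scale using that by (simp add: AV Aw)
      also have "\<dots> = l m * V m a - (c m * l m) * w a"
        unfolding cl [OF that(1)] ..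
      also have "\<dots> = l m * W m a"
        by (simp add: W_def algebra_simps)
      finally show ?thesis .
    qed
    moreover have "ip n (W m) (W r) = (if m = r then 1 else 0)" if "m < n" "r < n" for m r
    proof -
      have "ip n (W m) (W r) = ip n (V m) (V r) - c r * ip n (V m) w
          - c m * ip n (V r) w + c m * c r * N"
        unfolding W_def ip_linear N_def by (simp add: ip_commute [of n w "V r"] algebra_simps)
      also have "\<dots> = ip n (V m) (V r)"
        using False by (simp add: c_def field_simps)
      finally show ?thesis using VV that by simp
    qed
    ultimately have "eigenbasis n A l W" by (simp add: eigenbasis_def)
    moreover have "W k a = u a" if "a < n" for a
    proof -
      have "ip n (V k) w = - N / 2"
        unfolding w_def ip_linear N using VV [OF k k] by simp
      with False have "c k = -1" by (simp add: c_def)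
      then show ?thesis by (simp add: W_def w_def)
    qed
    moreover have "W m a = V m a" if "m < n" "m \<noteq> k" "ip n (V m) u = 0" for m a
    proof -
      have "ip n (V m) w = 0"
        unfolding w_def ip_linear using that k VV by simp
      then show ?thesis by (simp add: W_def c_def)
    qed
    ultimately show thesis by (rule that)
  qed
qed

text \<open>A simple eigenvalue has a one-dimensional eigenspace, so its unit eigenvectors agree up
  to sign. The sign can be absorbed into the diagonal factor of a matrix form, which carries such
  forms from one diagonalizer to another.\<close>

lemma eigenbasis_simple_eigenvalue:
  fixes A :: "nat \<Rightarrow> nat \<Rightarrow> real"
  assumes sym: "\<And>a b. a < n \<Longrightarrow> b < n \<Longrightarrow> A a b = A b a"
    and V: "eigenbasis n A l V" and U: "eigenbasis n A l U" and j: "j < n"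
    and simple: "\<And>k. k < n \<Longrightarrow> k \<noteq> j \<Longrightarrow> l k \<noteq> l j"
  obtains c where "c \<in> {1, -1}" "\<And>a. a < n \<Longrightarrow> V j a = c * U j a"
proof -
  define c where "c = ip n (U j) (V j)"
  have 0: "ip n (U k) (V j) = 0" if "k < n" "k \<noteq> j" for k
    by (rule eigenvectors_orthogonal [of n A _ "l k" _ "l j"])
      (use that sym V U j simple in \<open>auto simp: eigenbasis_def\<close>)
  have Vj: "V j a = c * U j a" if "a < n" for a
  proof -
    have "V j a = (\<Sum>k<n. ip n (U k) (V j) * U k a)"
      by (rule eigenbasis_expansion [OF U that])
    also have "\<dots> = (\<Sum>k<n. if k = j then c * U j a else 0)"
      by (intro sum.cong refl) (auto simp: 0 c_def)
    finally show ?thesis using j by simp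
  qed
  have "1 = ip n (V j) (V j)" using V j by (simp add: eigenbasis_def)
  also have "\<dots> = ip n (\<lambda>a. c * U j a) (\<lambda>a. c * U j a)"
    by (rule ip_cong) (simp_all add: Vj)
  also have "\<dots> = c\<^sup>2"
    unfolding ip_linear using U j by (simp add: eigenbasis_def power2_eq_square)
  finally have "c \<in> {1, -1}" by (auto simp: power2_eq_1_iff)
  with Vj that show ?thesis by blast
qed


section \<open>Fixed points as orthogonal eigenvectors\<close>

definition orthogonal_eigenvectors :: "nat \<Rightarrow> nat \<Rightarrow> (nat \<Rightarrow> nat \<Rightarrow> 'a::comm_ring_1) \<Rightarrow> (nat \<Rightarrow> nat \<Rightarrow> 'a) \<Rightarrow> bool" where
  "orthogonal_eigenvectors n p A X \<longleftrightarrow>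
    (\<forall>j<p. \<forall>a<n. mv n A (X j) a = - ip n (X j) (X j) * X j a) \<and>
    (\<forall>i<p. \<forall>j<p. i \<noteq> j \<longrightarrow> ip n (X i) (X j) = 0)"

text \<open>For \<open>i < j\<close> let \<open>c = ip n (X i) (X j)\<close>. Moving
  \<open>A\<close> across the inner product computes the same number as \<open>- |X i|^2 c\<close>
  from column \<open>i\<close> and as \<open>- |X i|^2 c - |X j|^2 c\<close> from the equation of
  column \<open>j\<close>, since the earlier columns are already orthogonal. Hence
  \<open>|X j|^2 c = 0\<close>, and \<open>c = 0\<close> also when \<open>X j\<close>
  vanishes.\<close>

lemma stationary_iff_orthogonal_eigenvectors:
  fixes A :: "nat \<Rightarrow> nat \<Rightarrow> real"
  assumes sym: "\<And>a b. a < n \<Longrightarrow> b < n \<Longrightarrow> A a b = A b a"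
  shows "(\<forall>j<p. \<forall>a<n. mv n A (X j) a + (\<Sum>i\<le>j. X i a * ip n (X i) (X j)) = 0)
    \<longleftrightarrow> orthogonal_eigenvectors n p A X" (is "?L \<longleftrightarrow> ?R")
proof
  assume L: ?L
  have main: "j < p \<Longrightarrow> (\<forall>a<n. mv n A (X j) a = - ip n (X j) (X j) * X j a)
    \<and> (\<forall>i<j. ip n (X i) (X j) = 0)" for j
  proof (induction j rule: less_induct)
    case (less j)
    have IH: "\<And>i a. i < j \<Longrightarrow> a < n \<Longrightarrow> mv n A (X i) a = - ip n (X i) (X i) * X i a"
      and orth': "\<And>i m. m < j \<Longrightarrow> i < m \<Longrightarrow> ip n (X i) (X m) = 0"
      using less by auto
    have orth: "ip n (X i) (X m) = 0" if "i < j" "m < j" "i \<noteq> m" for i m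
      using orth' [of m i] orth' [of i m] that by (metis ip_commute linorder_neqE_nat)
    have eq: "mv n A (X j) a = - (\<Sum>i\<le>j. ip n (X i) (X j) * X i a)" if "a < n" for a
    proof -
      have "mv n A (X j) a + (\<Sum>i\<le>j. X i a * ip n (X i) (X j)) = 0" using L less.prems that by blast
      then show ?thesis by (simp add: mult.commute)
    qed
    have 0: "ip n (X i) (X j) = 0" if i: "i < j" for i
    proof -
      let ?c = "ip n (X i) (X j)"
      have "ip n (mv n A (X i)) (X j) = - ip n (X i) (X i) * ?c"
        unfolding ip_scale_left [symmetric] by (rule ip_cong) (simp_all add: IH i)
      moreover have "ip n (X i) (mv n A (X j)) = ip n (X i) (\<lambda>a. (-1) * (\<Sum>m\<le>j. ip n (X m) (X j) * X m a))"
        by (rule ip_cong) (simp_all add: eq)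
      then have "ip n (X i) (mv n A (X j)) = - (\<Sum>m\<le>j. ip n (X m) (X j) * ip n (X i) (X m))"
        unfolding ip_scale_right ip_sum_right by simp
      moreover have "(\<Sum>m\<le>j. ip n (X m) (X j) * ip n (X i) (X m))
          = (\<Sum>m\<le>j. (if m = i then ?c * ip n (X i) (X i) else 0) + (if m = j then ip n (X j) (X j) * ?c else 0))"
        by (intro sum.cong refl) (use i orth in auto)
      then have "(\<Sum>m\<le>j. ip n (X m) (X j) * ip n (X i) (X m)) = ?c * ip n (X i) (X i) + ip n (X j) (X j) * ?c"
        using i by (simp add: sum.distrib)
      ultimately have "ip n (X j) (X j) * ?c = 0"
        using ip_mv_symmetric [of n A "X i" "X j"] sym by simp
      then show ?thesis using ip_self_0_ip [of n "X j" "X i"] by auto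
    qed
    have "(\<Sum>i\<le>j. ip n (X i) (X j) * X i a) = (\<Sum>i\<le>j. if i = j then ip n (X j) (X j) * X j a else 0)" for a
      by (intro sum.cong refl) (auto simp: 0)
    with eq 0 show ?case by simp
  qed
  have "ip n (X i) (X j) = 0" if "i < p" "j < p" "i \<noteq> j" for i j
    using main [of i] main [of j] that by (metis ip_commute linorder_neqE_nat)
  with main show ?R by (simp add: orthogonal_eigenvectors_def)
next
  assume R: ?R
  show ?L
  proof (intro allI impI)
    fix j a assume ja: "j < p" "a < n"
    have "(\<Sum>i\<le>j. X i a * ip n (X i) (X j)) = (\<Sum>i\<le>j. if i = j then X j a * ip n (X j) (X j) else 0)"
      by (intro sum.cong refl) (use R ja in \<open>auto simp: orthogonal_eigenvectors_def\<close>)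
    then show "mv n A (X j) a + (\<Sum>i\<le>j. X i a * ip n (X i) (X j)) = 0"
      using R ja by (simp add: orthogonal_eigenvectors_def mult.commute)
  qed
qed

text \<open>Over the reals the cubic condition says that \<open>c j = 0\<close> or
  \<open>l (\<sigma> j) = - (c j)^2\<close>, so vanishing columns and columns of the right length
  are treated at once.\<close>

lemma orthogonal_eigenvectors_scaled_basis:
  assumes V: "eigenbasis n A l V" and inj: "inj_on \<sigma> {..<p}" and \<sigma>: "\<And>j. j < p \<Longrightarrow> \<sigma> j < n"
    and X: "\<And>j a. j < p \<Longrightarrow> a < n \<Longrightarrow> X j a = c j * V (\<sigma> j) a"
    and c: "\<And>j. j < p \<Longrightarrow> c j * l (\<sigma> j) = - (c j * c j * c j)"
  shows "orthogonal_eigenvectors n p A X"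
proof -
  have ip: "ip n (X i) (X j) = (if i = j then c i * c j else 0)" if "i < p" "j < p" for i j
  proof -
    have "ip n (X i) (X j) = ip n (\<lambda>a. c i * V (\<sigma> i) a) (\<lambda>a. c j * V (\<sigma> j) a)"
      by (rule ip_cong) (use that X in auto)
    also have "\<dots> = (if \<sigma> i = \<sigma> j then c i * c j else 0)"
      unfolding ip_linear using V \<sigma> that by (simp add: eigenbasis_def)
    finally show ?thesis using inj that by (auto simp: inj_on_def)
  qed
  have "mv n A (X j) a = - ip n (X j) (X j) * X j a" if "j < p" "a < n" for j a
  proof -
    have "mv n A (X j) a = mv n A (\<lambda>a. c j * V (\<sigma> j) a) a"
      by (rule mv_cong) (use that X in auto)
    also have "\<dots> = c j * l (\<sigma> j) * V (\<sigma> j) a"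
      unfolding mv_scale using V \<sigma> that by (simp add: eigenbasis_def)
    finally show ?thesis using that X ip by (simp add: c mult.assoc)
  qed
  with ip show ?thesis by (simp add: orthogonal_eigenvectors_def)
qed

text \<open>The normalised nonzero columns enter the basis one after another by
  \<open>eigenbasis_replace\<close>, and \<open>\<sigma>\<close> records their places. A zero column
  occupies no place, so \<open>\<sigma>\<close> is constrained only at nonzero columns.\<close>

lemma orthogonal_eigenvectors_in_basis:
  fixes A :: "nat \<Rightarrow> nat \<Rightarrow> real"
  assumes sym: "\<And>a b. a < n \<Longrightarrow> b < n \<Longrightarrow> A a b = A b a"
    and U: "eigenbasis n A l U" and X: "orthogonal_eigenvectors n p A X"
  obtains V \<sigma> where "eigenbasis n A l V" "inj_on \<sigma> {j. j < p \<and> ip n (X j) (X j) \<noteq> 0}"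
    "\<And>j. j < p \<Longrightarrow> ip n (X j) (X j) \<noteq> 0 \<Longrightarrow> \<sigma> j < n \<and> l (\<sigma> j) = - ip n (X j) (X j)"
    "\<And>j a. j < p \<Longrightarrow> ip n (X j) (X j) \<noteq> 0 \<Longrightarrow> a < n \<Longrightarrow> X j a = sqrt (ip n (X j) (X j)) * V (\<sigma> j) a"
proof -
  let ?d = "\<lambda>j. ip n (X j) (X j)"
  have AX: "\<And>j a. j < p \<Longrightarrow> a < n \<Longrightarrow> mv n A (X j) a = - ?d j * X j a"
    and XX: "\<And>i j. i < p \<Longrightarrow> j < p \<Longrightarrow> i \<noteq> j \<Longrightarrow> ip n (X i) (X j) = 0"
    using X by (auto simp: orthogonal_eigenvectors_def)
  have "m \<le> p \<Longrightarrow> \<exists>V \<sigma>. eigenbasis n A l V \<and> inj_on \<sigma> {j. j < m \<and> ?d j \<noteq> 0} \<and>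
     (\<forall>j<m. ?d j \<noteq> 0 \<longrightarrow> \<sigma> j < n \<and> l (\<sigma> j) = - ?d j \<and> (\<forall>a<n. X j a = sqrt (?d j) * V (\<sigma> j) a))" for m
  proof (induction m)
    case 0
    then show ?case using U by auto
  next
    case (Suc m)
    then obtain V \<sigma> where V: "eigenbasis n A l V" and inj: "inj_on \<sigma> {j. j < m \<and> ?d j \<noteq> 0}"
      and \<sigma>: "\<And>j. j < m \<Longrightarrow> ?d j \<noteq> 0 \<Longrightarrow> \<sigma> j < n \<and> l (\<sigma> j) = - ?d j \<and> (\<forall>a<n. X j a = sqrt (?d j) * V (\<sigma> j) a)"
      by auto
    have m: "m < p" using Suc by simp
    show ?case
    proof (cases "?d m = 0")
      case True
      then have "{j. j < Suc m \<and> ?d j \<noteq> 0} = {j. j < m \<and> ?d j \<noteq> 0}"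
        by (auto simp: less_Suc_eq)
      then show ?thesis using V inj \<sigma> True by (intro exI [of _ V] exI [of _ \<sigma>]) (auto simp: less_Suc_eq)
    next
      case False
      then have d: "?d m > 0" using ip_self_nonneg [of n "X m"] by simp
      define u where "u = (\<lambda>a. 1 / sqrt (?d m) * X m a)"
      have u1: "ip n u u = 1"
        unfolding u_def ip_linear using d by (simp add: field_simps)
      have Au: "mv n A u a = - ?d m * u a" if "a < n" for a
        unfolding u_def mv_scale using AX [OF m that] by simp
      from u1 obtain a where "a < n" "u a \<noteq> 0"
        using ip_self_eq_0_iff [of n u] by auto
      then obtain k where k: "k < n" and c: "ip n (V k) u \<noteq> 0"
        using eigenbasis_coefficient_nonzero [OF V] by blast
      have lk: "l k = - ?d m"
      proof (rule ccontr)
        assume "l k \<noteq> - ?d m"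
        then have "ip n (V k) u = 0"
          by (intro eigenvectors_orthogonal [of n A _ "l k" _ "- ?d m"])
            (use sym V k Au in \<open>auto simp: eigenbasis_def\<close>)
        with c show False by simp
      qed
      have V\<sigma>u: "ip n (V (\<sigma> j)) u = 0" if "j < m" "?d j \<noteq> 0" for j
      proof -
        have "0 = ip n (X j) (X m)" using XX that m by simp
        also have "\<dots> = ip n (\<lambda>a. sqrt (?d j) * V (\<sigma> j) a) (\<lambda>a. sqrt (?d m) * u a)"
          by (rule ip_cong) (use that \<sigma> d in \<open>auto simp: u_def\<close>)
        also have "\<dots> = sqrt (?d j) * sqrt (?d m) * ip n (V (\<sigma> j)) u"
          unfolding ip_linear by simp
        finally show ?thesis using that(2) False by auto
      qed
      have nk: "\<sigma> j \<noteq> k" if "j < m" "?d j \<noteq> 0" for j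
        using V\<sigma>u [OF that] c by auto
      obtain W where W: "eigenbasis n A l W" "\<And>a. a < n \<Longrightarrow> W k a = u a"
        "\<And>m a. m < n \<Longrightarrow> m \<noteq> k \<Longrightarrow> ip n (V m) u = 0 \<Longrightarrow> a < n \<Longrightarrow> W m a = V m a"
        by (rule eigenbasis_replace [OF sym V k u1]) (use Au lk in auto)
      have eq: "{j. j < Suc m \<and> ?d j \<noteq> 0} = insert m {j. j < m \<and> ?d j \<noteq> 0}"
        using False by (auto simp: less_Suc_eq)
      have "inj_on (\<sigma>(m := k)) {j. j < Suc m \<and> ?d j \<noteq> 0}"
        unfolding eq using inj nk by (auto simp: inj_on_def)
      moreover have "\<forall>j<Suc m. ?d j \<noteq> 0 \<longrightarrow> (\<sigma>(m := k)) j < n \<and> l ((\<sigma>(m := k)) j) = - ?d j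
          \<and> (\<forall>a<n. X j a = sqrt (?d j) * W ((\<sigma>(m := k)) j) a)"
        using \<sigma> k lk W nk V\<sigma>u d by (auto simp: less_Suc_eq u_def)
      ultimately show ?thesis using W(1) by blast
    qed
  qed
  from this [OF order_refl] obtain V \<sigma> where "eigenbasis n A l V" "inj_on \<sigma> {j. j < p \<and> ?d j \<noteq> 0}"
    and \<sigma>: "\<forall>j<p. ?d j \<noteq> 0 \<longrightarrow> \<sigma> j < n \<and> l (\<sigma> j) = - ?d j \<and> (\<forall>a<n. X j a = sqrt (?d j) * V (\<sigma> j) a)"
    by (elim exE conjE)
  from this(1,2) show ?thesis
  proof (rule that)
    fix j assume "j < p" "?d j \<noteq> 0"
    then show "\<sigma> j < n \<and> l (\<sigma> j) = - ?d j" using \<sigma> by blast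
  next
    fix j a assume "j < p" "?d j \<noteq> 0" "a < n"
    then show "X j a = sqrt (?d j) * V (\<sigma> j) a" using \<sigma> by blast
  qed
qed

text \<open>Here the places are prescribed: \<open>u j\<close> goes to place \<open>j\<close>. This
  is possible because its eigenvalue is exactly \<open>l j\<close>; the reflection then works even
  if the old vector at that place is orthogonal to \<open>u j\<close>.\<close>

lemma eigenbasis_extending:
  fixes A :: "nat \<Rightarrow> nat \<Rightarrow> real"
  assumes sym: "\<And>a b. a < n \<Longrightarrow> b < n \<Longrightarrow> A a b = A b a"
    and U: "eigenbasis n A l U" and "p \<le> n"
    and u: "\<And>i j. i < p \<Longrightarrow> j < p \<Longrightarrow> ip n (u i) (u j) = (if i = j then 1 else 0)"
    and Au: "\<And>j a. j < p \<Longrightarrow> a < n \<Longrightarrow> mv n A (u j) a = l j * u j a"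
  obtains V where "eigenbasis n A l V" "\<And>j a. j < p \<Longrightarrow> a < n \<Longrightarrow> V j a = u j a"
proof -
  have "m \<le> p \<Longrightarrow> \<exists>V. eigenbasis n A l V \<and> (\<forall>j<m. \<forall>a<n. V j a = u j a)" for m
  proof (induction m)
    case 0
    then show ?case using U by auto
  next
    case (Suc m)
    then obtain V where V: "eigenbasis n A l V" and Vu: "\<forall>j<m. \<forall>a<n. V j a = u j a" by auto
    have m: "m < p" "m < n" using Suc.prems \<open>p \<le> n\<close> by auto
    obtain W where W: "eigenbasis n A l W" "\<And>a. a < n \<Longrightarrow> W m a = u m a"
      "\<And>k a. k < n \<Longrightarrow> k \<noteq> m \<Longrightarrow> ip n (V k) (u m) = 0 \<Longrightarrow> a < n \<Longrightarrow> W k a = V k a"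
      by (rule eigenbasis_replace [OF sym V m(2), of "u m"]) (use u Au m in auto)
    have "ip n (V j) (u m) = 0" if "j < m" for j
    proof -
      have "ip n (V j) (u m) = ip n (u j) (u m)"
        by (rule ip_cong) (use Vu that in auto)
      then show ?thesis using u that m by simp
    qed
    then show ?case using W Vu m by (intro exI [of _ W]) (auto simp: less_Suc_eq)
  qed
  from this [of p] that show ?thesis by blast
qed


section \<open>The derivative of the iteration map\<close>

text \<open>The product rule for entry \<open>(a, j)\<close> of \<open>A X + X triu(X^T X)\<close>,
  differentiated at \<open>X\<close> in the direction \<open>E\<close>. The general ring admits
  complex directions, as needed for complex eigenvectors.\<close>

definition g1_deriv :: "nat \<Rightarrow> (nat \<Rightarrow> nat \<Rightarrow> 'a::comm_ring_1) \<Rightarrow> (nat \<Rightarrow> nat \<Rightarrow> 'a) \<Rightarrow> (nat \<Rightarrow> nat \<Rightarrow> 'a)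
    \<Rightarrow> nat \<Rightarrow> nat \<Rightarrow> 'a" where
  "g1_deriv n A X E j a = mv n A (E j) a +
    (\<Sum>i\<le>j. E i a * ip n (X i) (X j) + X i a * (ip n (E i) (X j) + ip n (X i) (E j)))"

text \<open>The bound \<open>i \<le> j\<close> is the block triangular shape. For
  \<open>j < p\<close> it makes the values of a direction outside the \<open>n\<close> by
  \<open>p\<close> window irrelevant.\<close>

lemma g1_deriv_cong:
  assumes "\<And>i a. i \<le> j \<Longrightarrow> a < n \<Longrightarrow> E i a = F i a" "a < n"
  shows "g1_deriv n A X E j a = g1_deriv n A X F j a"
proof -
  have "mv n A (E j) a = mv n A (F j) a"
    by (rule mv_cong) (simp add: assms)
  moreover have "ip n (E i) (X j) = ip n (F i) (X j)" "ip n (X i) (E j) = ip n (X i) (F j)"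
    if "i \<le> j" for i
    by (rule ip_cong; use assms that in simp)+
  ultimately show ?thesis using assms by (simp add: g1_deriv_def)
qed

lemma g1_deriv_add: "g1_deriv n A X (\<lambda>j a. E j a + F j a) j a = g1_deriv n A X E j a + g1_deriv n A X F j a"
  unfolding g1_deriv_def ip_linear by (simp add: mv_def sum.distrib algebra_simps)

lemma g1_deriv_scale: "g1_deriv n A X (\<lambda>j a. c * E j a) j a = c * g1_deriv n A X E j a"
  unfolding g1_deriv_def ip_linear mv_scale distrib_left sum_distrib_left
  by (simp add: algebra_simps)

lemma g1_deriv_sum:
  "g1_deriv n A X (\<lambda>j a. \<Sum>s\<in>S. w s * D s j a) j a = (\<Sum>s\<in>S. w s * g1_deriv n A X (D s) j a)"
proof (induction S rule: infinite_finite_induct)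
  case (insert s S)
  then show ?case by (simp add: g1_deriv_add g1_deriv_scale)
qed (simp_all add: g1_deriv_def mv_def ip_def)

lemma g1_deriv_of_real:
  "g1_deriv n (\<lambda>a b. of_real (A a b)) (\<lambda>j a. of_real (X j a)) (\<lambda>j a. of_real (E j a)) j a
    = (of_real (g1_deriv n A X E j a) :: 'a::{comm_ring_1,real_algebra_1})"
  by (simp add: g1_deriv_def ip_def mv_def)

lemma has_field_derivative_g1_deriv:
  fixes X E :: "nat \<Rightarrow> nat \<Rightarrow> real"
  shows "((\<lambda>t. mv n A (\<lambda>a. X j a + t * E j a) b +
      (\<Sum>i\<le>j. (X i b + t * E i b) * ip n (\<lambda>a. X i a + t * E i a) (\<lambda>a. X j a + t * E j a)))
    has_field_derivative g1_deriv n A X E j b) (at 0)"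
proof -
  have ip: "((\<lambda>t. ip n (\<lambda>a. X i a + t * E i a) (\<lambda>a. X j a + t * E j a))
    has_field_derivative (ip n (E i) (X j) + ip n (X i) (E j))) (at 0)" for i
    unfolding ip_def sum.distrib [symmetric]
    by (rule DERIV_sum) (auto intro!: derivative_eq_intros simp: algebra_simps)
  have mv: "((\<lambda>t. mv n A (\<lambda>a. X j a + t * E j a) b) has_field_derivative mv n A (E j) b) (at 0)"
    unfolding mv_def by (rule DERIV_sum) (auto intro!: derivative_eq_intros simp: algebra_simps)
  show ?thesis unfolding g1_deriv_def
    by (rule DERIV_add [OF mv DERIV_sum]) (auto intro!: derivative_eq_intros ip simp: algebra_simps)
qed

lemma g1_deriv_real_eigenvector:
  fixes A :: "nat \<Rightarrow> nat \<Rightarrow> real"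
  assumes X: "orthogonal_eigenvectors n p A X" and j: "j < p"
    and uX: "\<And>i. i \<le> j \<Longrightarrow> ip n u (X i) = 0"
    and Au: "\<And>a. a < n \<Longrightarrow> mv n A u a = \<kappa> * u a"
    and \<kappa>: "\<kappa> + ip n (X j) (X j) \<le> 0"
  obtains E where "E j = u"
    "\<And>l a. l < p \<Longrightarrow> a < n \<Longrightarrow> g1_deriv n A X E l a = (\<kappa> + ip n (X j) (X j)) * E l a"
proof -
  let ?d = "\<lambda>j. ip n (X j) (X j)"
  have AX: "\<And>j a. j < p \<Longrightarrow> a < n \<Longrightarrow> mv n A (X j) a = - ?d j * X j a"
    and XX: "\<And>i j. i < p \<Longrightarrow> j < p \<Longrightarrow> i \<noteq> j \<Longrightarrow> ip n (X i) (X j) = 0"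
    using X by (auto simp: orthogonal_eigenvectors_def)
  define c where "c = (\<lambda>l. ip n u (X l) / (\<kappa> + ?d j - ?d l))"
  \<comment> \<open>The Jacobian is block lower triangular; \<open>u\<close> in block \<open>j\<close> is completed by solving for
    the later blocks, where the correction is a multiple of \<open>X j\<close>.\<close>
  define E where "E = (\<lambda>l a. if l = j then u a else if j < l then c l * X j a else 0)"
  have Ej: "E j = u" and El: "\<And>l. j < l \<Longrightarrow> E l = (\<lambda>a. c l * X j a)"
    and E0: "\<And>l. l < j \<Longrightarrow> E l = (\<lambda>a. 0)"
    by (auto simp: E_def)
  \<comment> \<open>This is the equation that column \<open>l\<close> imposes on \<open>c l\<close>.
    As \<open>\<kappa> + ?d j \<le> 0 \<le> ?d l\<close>, the denominator vanishes only if
    \<open>X l = 0\<close>; then both sides are 0 and the default quotient 0 is a solution.\<close>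
  have c: "c l * (\<kappa> + ?d j) = c l * ?d l + ip n u (X l)" for l
  proof (cases "\<kappa> + ?d j - ?d l = 0")
    case True
    then have "?d l = 0" using \<kappa> ip_self_nonneg [of n "X l"] by linarith
    then have "ip n u (X l) = 0" by (rule ip_self_0_ip)
    then show ?thesis by (simp add: c_def)
  next
    case False
    then have "c l * (\<kappa> + ?d j - ?d l) = ip n u (X l)" by (simp add: c_def)
    then show ?thesis by (simp add: algebra_simps)
  qed
  have "g1_deriv n A X E l a = (\<kappa> + ?d j) * E l a" if l: "l < p" and a: "a < n" for l a
  proof -
    consider "l < j" | "l = j" | "j < l" by linarith
    then show ?thesis
    proof cases
      case 1
      have "(\<Sum>i\<le>l. E i a * ip n (X i) (X l) + X i a * (ip n (E i) (X l) + ip n (X i) (E l))) = 0"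
        by (rule sum.neutral) (use 1 E0 in auto)
      then show ?thesis using 1 E0 by (simp add: g1_deriv_def mv_def)
    next
      case 2
      have "(\<Sum>i\<le>l. E i a * ip n (X i) (X l) + X i a * (ip n (E i) (X l) + ip n (X i) (E l)))
        = (\<Sum>i\<le>l. if i = j then u a * ?d j else 0)"
        by (intro sum.cong refl) (use 2 E0 Ej uX in \<open>auto simp: ip_commute [of n "X _" u] le_less\<close>)
      then show ?thesis using 2 Ej Au [OF a] by (simp add: g1_deriv_def algebra_simps)
    next
      case 3
      have "(\<Sum>i\<le>l. E i a * ip n (X i) (X l) + X i a * (ip n (E i) (X l) + ip n (X i) (E l)))
        = (\<Sum>i\<le>l. (if i = l then c l * X j a * ?d l else 0) +
            (if i = j then X j a * (ip n u (X l) + c l * ?d j) else 0))"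
      proof (intro sum.cong refl)
        fix i assume i: "i \<in> {..l}"
        have "E i a * ip n (X i) (X l) = (if i = l then c l * X j a * ?d l else 0)"
          using XX [of i l] El [of l] i l 3 by auto
        moreover have "ip n (E i) (X l) = (if i = j then ip n u (X l) else 0)"
        proof (cases "j < i")
          case True
          then show ?thesis using XX [of j l] j l 3 by (simp add: El ip_linear)
        qed (use E0 [of i] Ej in \<open>auto simp: not_less le_less\<close>)
        moreover have "ip n (X i) (E l) = (if i = j then c l * ?d j else 0)"
          using XX [of i j] i l j 3 by (simp add: El ip_linear)
        ultimately show "E i a * ip n (X i) (X l) + X i a * (ip n (E i) (X l) + ip n (X i) (E l))
          = (if i = l then c l * X j a * ?d l else 0) +
            (if i = j then X j a * (ip n u (X l) + c l * ?d j) else 0)"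
          by auto
      qed
      also have "\<dots> = c l * X j a * ?d l + X j a * (ip n u (X l) + c l * ?d j)"
        using 3 by (simp add: sum.distrib)
      \<comment> \<open>The term \<open>c l * ?d j\<close> cancels against \<open>A\<close> applied
        to \<open>c l\<close> times \<open>X j\<close>.\<close>
      finally have "g1_deriv n A X E l a = (c l * ?d l + ip n u (X l)) * X j a"
        unfolding g1_deriv_def El [OF 3] mv_scale using AX [OF j a] by (simp add: algebra_simps)
      also have "\<dots> = (\<kappa> + ?d j) * E l a"
        unfolding c [symmetric] El [OF 3] by simp
      finally show ?thesis .
    qed
  qed
  with Ej that show thesis by blast
qed

text \<open>The diagonal block of column \<open>j\<close> is
  \<open>A - l j + sum_{i \<le> j} x_i x_i^T + x_j x_j^T\<close>, which is diagonal in the basis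
  \<open>V\<close>. On \<open>V k\<close> with \<open>k \<le> j\<close> the rank-one sum cancels
  \<open>l k\<close>, and for \<open>k = j\<close> the last term contributes a further
  \<open>- l j\<close>.\<close>

lemma g1_deriv_eigenvalue_cases:
  fixes A :: "nat \<Rightarrow> nat \<Rightarrow> 'a::field"
  assumes sym: "\<And>a b. a < n \<Longrightarrow> b < n \<Longrightarrow> A a b = A b a"
    and V: "eigenbasis n A l V" and pn: "p \<le> n"
    and X: "\<And>j a. j < p \<Longrightarrow> a < n \<Longrightarrow> X j a = c j * V j a"
    and c: "\<And>j. j < p \<Longrightarrow> c j * c j = - l j"
    and E0: "\<exists>j<p. \<exists>a<n. E j a \<noteq> 0"
    and E: "\<And>j a. j < p \<Longrightarrow> a < n \<Longrightarrow> g1_deriv n A X E j a = z * E j a"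
  obtains j k where "j < p" "k < n"
    "z = (if k < j then - l j else if k = j then - 2 * l j else l k - l j)"
proof -
  \<comment> \<open>The first nonzero column of an eigenvector is an eigenvector of a diagonal block.\<close>
  define j where "j = (LEAST j. j < p \<and> (\<exists>a<n. E j a \<noteq> 0))"
  have j: "j < p" "\<exists>a<n. E j a \<noteq> 0"
    using LeastI_ex [of "\<lambda>j. j < p \<and> (\<exists>a<n. E j a \<noteq> 0)"] E0 unfolding j_def by blast+
  have Ei: "E i a = 0" if "i < j" "a < n" for i a
    using not_less_Least [of i "\<lambda>j. j < p \<and> (\<exists>a<n. E j a \<noteq> 0)"] that j(1) unfolding j_def by auto
  obtain a k where "a < n" "E j a \<noteq> 0" and k: "k < n" and ck: "ip n (V k) (E j) \<noteq> 0"
    using eigenbasis_coefficient_nonzero [OF V] j(2) by metis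
  define e where "e = (\<lambda>i. ip n (V i) (E j))"
  have VV: "\<And>m r. m < n \<Longrightarrow> r < n \<Longrightarrow> ip n (V m) (V r) = (if m = r then 1 else 0)"
    using V by (auto simp: eigenbasis_def)
  have Xe: "ip n (X i) (E j) = c i * e i" if "i < p" for i
    unfolding e_def ip_scale_left [symmetric] by (rule ip_cong) (use X that in auto)
  have VX: "ip n (V m) (X i) = (if m = i then c i else 0)" if "i < p" "m < n" for i m
  proof -
    have "ip n (V m) (X i) = ip n (V m) (\<lambda>a. c i * V i a)"
      by (rule ip_cong) (use X that in auto)
    then show ?thesis using VV [of m i] that pn by (simp add: ip_linear)
  qed
  have XX: "ip n (X j) (X j) = - l j"
  proof -
    have "ip n (X j) (X j) = ip n (\<lambda>a. c j * V j a) (X j)"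
      by (rule ip_cong) (use X j in auto)
    also have "\<dots> = - l j" unfolding ip_linear using VX [of j j] c j pn by simp
    finally show ?thesis .
  qed
  \<comment> \<open>The earlier columns of \<open>E\<close> are zero, so only the diagonal block
    survives. The extra \<open>c j * e j * X j a\<close> arises because both factors of
    \<open>ip n (X j) (X j)\<close> are differentiated.\<close>
  have z: "z * E j a = mv n A (E j) a + (- l j) * E j a + (\<Sum>i\<le>j. c i * e i * X i a) + c j * e j * X j a"
    if a: "a < n" for a
  proof -
    have 0: "ip n (E i) (X j) = 0" if "i < j" for i
      using Ei [OF that] by (simp add: ip_def)
    have "(\<Sum>i\<le>j. E i a * ip n (X i) (X j) + X i a * (ip n (E i) (X j) + ip n (X i) (E j)))
      = (\<Sum>i\<le>j. c i * e i * X i a + (if i = j then (- l j) * E j a + c j * e j * X j a else 0))"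
      by (intro sum.cong refl)
        (use j a Ei 0 in \<open>auto simp: Xe XX ip_commute [of n "E j" "X j"] le_less algebra_simps\<close>)
    then show ?thesis unfolding E [OF j(1) a, symmetric] g1_deriv_def
      by (simp add: sum.distrib)
  qed
  have ck2: "c k * (c k * e k) = - (e k * l k)" if "k < p"
    using c [OF that] by (metis mult.assoc mult.commute mult_minus_left)
  have "z * e k = ip n (V k) (\<lambda>a. z * E j a)"
    by (simp add: e_def ip_linear)
  also have "\<dots> = ip n (V k) (\<lambda>a. mv n A (E j) a + (- l j) * E j a + (\<Sum>i\<le>j. c i * e i * X i a) + c j * e j * X j a)"
    by (rule ip_cong) (simp_all add: z)
  also have "\<dots> = ip n (V k) (mv n A (E j)) + (- l j) * e k
      + (\<Sum>i\<le>j. c i * e i * ip n (V k) (X i)) + c j * e j * ip n (V k) (X j)"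
    unfolding ip_linear ip_sum_right e_def ..
  also have "ip n (V k) (mv n A (E j)) = ip n (mv n A (V k)) (E j)"
    using ip_mv_symmetric [of n A, OF sym] by simp
  also have "\<dots> = l k * e k"
    unfolding e_def ip_scale_left [symmetric] by (rule ip_cong) (use V k in \<open>auto simp: eigenbasis_def\<close>)
  also have "(\<Sum>i\<le>j. c i * e i * ip n (V k) (X i)) = (\<Sum>i\<le>j. if i = k then - l k * e k else 0)"
    by (intro sum.cong refl) (use j k ck2 in \<open>auto simp: VX mult.commute mult.left_commute\<close>)
  also have "\<dots> = (if k \<le> j then - l k * e k else 0)" by simp
  also have "c j * e j * ip n (V k) (X j) = (if k = j then - l k * e k else 0)"
    using VX [of j k] ck2 j k by (auto simp: mult.commute mult.left_commute)
  also have "l k * e k + - l j * e k + (if k \<le> j then - l k * e k else 0) + (if k = j then - l k * e k else 0)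
      = (if k < j then - l j else if k = j then - 2 * l j else l k - l j) * e k"
    by (auto simp: algebra_simps)
  finally have eq: "z * e k = (if k < j then - l j else if k = j then - 2 * l j else l k - l j) * e k" .
  have "e k \<noteq> 0" using ck by (simp add: e_def)
  from mult_right_cancel [THEN iffD1, OF this eq]
  show thesis by (rule that [OF j(1) k])
qed


section \<open>Translation to matrices\<close>

definition column :: "'a mat \<Rightarrow> nat \<Rightarrow> nat \<Rightarrow> 'a" where
  "column M j a = M $$ (a, j)"

abbreviation entry :: "'a mat \<Rightarrow> nat \<Rightarrow> nat \<Rightarrow> 'a" where
  "entry A a b \<equiv> A $$ (a, b)"

lemma index_mult_diagonal:
  fixes M D :: "'a::semiring_0 mat"
  assumes "M \<in> carrier_mat n k" "D \<in> carrier_mat k k" "diagonal_mat D" "a < n" "j < k"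
  shows "(M * D) $$ (a, j) = M $$ (a, j) * D $$ (j, j)"
proof -
  have "(M * D) $$ (a, j) = (\<Sum>i<k. M $$ (a, i) * D $$ (i, j))"
    using assms by (simp add: scalar_prod_def atLeast0LessThan)
  also have "\<dots> = (\<Sum>i<k. if i = j then M $$ (a, j) * D $$ (j, j) else 0)"
    by (intro sum.cong refl) (use assms in \<open>auto simp: diagonal_mat_def\<close>)
  finally show ?thesis using assms by simp
qed

lemma Lambda_carrier: "A \<in> carrier_mat n n \<Longrightarrow> Lambda A \<in> carrier_mat n n"
  and Lambda_diagonal: "diagonal_mat (Lambda A)"
  and Lambda_index: "A \<in> carrier_mat n n \<Longrightarrow> i < n \<Longrightarrow> j < n \<Longrightarrow>
    Lambda A $$ (i, j) = (if i = j then eigs A ! i else 0)"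
  by (auto simp: Lambda_def mat_diag_def diagonal_mat_def)

text \<open>A square \<open>V\<close> with \<open>V^T V = 1\<close> also has
  \<open>V V^T = 1\<close>, so \<open>V^T A V = Lambda A\<close> may be multiplied by
  \<open>V\<close> from the left to give the columnwise equation \<open>A V = V Lambda A\<close>,
  and back.\<close>

lemma diagonalizer_iff_eigenbasis:
  assumes A: "A \<in> carrier_mat n n"
  shows "diagonalizer A V \<longleftrightarrow>
    V \<in> carrier_mat n n \<and> eigenbasis n (entry A) ((!) (eigs A)) (column V)"
proof (cases "V \<in> carrier_mat n n")
  case V: True
  have L: "Lambda A \<in> carrier_mat n n" by (rule Lambda_carrier [OF A])
  have orth: "V\<^sup>T * V = 1\<^sub>m n \<longleftrightarrow>
      (\<forall>k<n. \<forall>m<n. ip n (column V k) (column V m) = (if k = m then 1 else 0))"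
    using V by (auto simp: mat_eq_iff scalar_prod_def ip_def column_def atLeast0LessThan)
  have eig: "A * V = V * Lambda A \<longleftrightarrow>
      (\<forall>k<n. \<forall>a<n. mv n (entry A) (column V k) a = eigs A ! k * column V k a)"
  proof -
    have "(A * V) $$ (a, k) = mv n (entry A) (column V k) a" if "a < n" "k < n" for a k
      using A V that by (simp add: mv_def column_def scalar_prod_def atLeast0LessThan)
    moreover have "(V * Lambda A) $$ (a, k) = eigs A ! k * column V k a" if "a < n" "k < n" for a k
      using index_mult_diagonal [OF V L Lambda_diagonal that] Lambda_index [OF A that(2,2)]
      by (simp add: column_def)
    ultimately show ?thesis using A V L by (auto simp: mat_eq_iff)
  qed
  have "V\<^sup>T * A * V = Lambda A \<longleftrightarrow> A * V = V * Lambda A" if 1: "V\<^sup>T * V = 1\<^sub>m n"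
  proof
    have "V * V\<^sup>T = 1\<^sub>m n"
      by (rule mat_mult_left_right_inverse [OF _ V 1]) (use V in auto)
    moreover have "V * (V\<^sup>T * A * V) = (V * V\<^sup>T) * (A * V)"
      using A V by (simp add: assoc_mult_mat [of _ n n _ n _ n])
    ultimately show "A * V = V * Lambda A" if "V\<^sup>T * A * V = Lambda A"
      using that A V by simp
  next
    assume "A * V = V * Lambda A"
    have "V\<^sup>T * A * V = V\<^sup>T * (A * V)"
      using A V by (simp add: assoc_mult_mat [of _ n n _ n _ n])
    also have "\<dots> = (V\<^sup>T * V) * Lambda A"
      unfolding \<open>A * V = V * Lambda A\<close> using V L by (simp add: assoc_mult_mat [of _ n n _ n _ n])
    finally show "V\<^sup>T * A * V = Lambda A" using 1 L by simp
  qed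
  then show ?thesis
    using A V orth eig by (auto simp: diagonalizer_def eigenbasis_def)
qed (use A in \<open>simp add: diagonalizer_def\<close>)

text \<open>The given diagonalizer makes \<open>A\<close> similar to \<open>Lambda A\<close>, a
  diagonal matrix of size \<open>n\<close> whatever the length of \<open>eigs A\<close>. So the
  characteristic polynomial is a product of \<open>n\<close> real linear factors.\<close>

lemma length_eigs:
  assumes A: "A \<in> carrier_mat n n" and U: "diagonalizer A U"
  shows "length (eigs A) = n"
proof -
  have Uc: "U \<in> carrier_mat n n" and 1: "U\<^sup>T * U = 1\<^sub>m n" and L: "U\<^sup>T * A * U = Lambda A"
    using A U by (auto simp: diagonalizer_def)
  have 2: "U * U\<^sup>T = 1\<^sub>m n"
    by (rule mat_mult_left_right_inverse [OF _ Uc 1]) (use Uc in auto)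
  have "similar_mat (Lambda A) A"
    unfolding similar_mat_def
    by (intro exI [of _ "U\<^sup>T"] exI [of _ U] similar_mat_witI [of "U\<^sup>T" U n]) (use A Uc 1 2 L Lambda_carrier [OF A] in auto)
  then have "char_poly A = char_poly (Lambda A)"
    by (rule char_poly_similar [symmetric])
  also have "\<dots> = (\<Prod>a\<leftarrow>diag_mat (Lambda A). [:- a, 1:])"
    by (rule char_poly_upper_triangular [OF Lambda_carrier [OF A]])
      (auto simp: upper_triangular_def Lambda_def mat_diag_def)
  finally have "size (proots (char_poly A)) = size (proots (\<Prod>a\<leftarrow>diag_mat (Lambda A). [:- a, 1:]))"
    by simp
  also have "\<dots> = length (diag_mat (Lambda A))"
  proof -
    have "size (proots (\<Prod>a\<leftarrow>as. [:- a, 1:])) = length as" for as :: "real list"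
    proof (induction as)
      case (Cons a as)
      have "(\<Prod>a\<leftarrow>as. [:- a, 1:]) \<noteq> 0" by (auto simp: prod_list_zero_iff)
      then show ?case using Cons by (simp add: proots_mult del: mult_pCons_left)
    qed simp
    then show ?thesis .
  qed
  also have "\<dots> = n"
    using Lambda_carrier [OF A] by (simp add: diag_mat_def)
  finally show ?thesis
    by (metis eigs_def mset_sorted_list_of_multiset size_mset)
qed

lemma sorted_eigs: "sorted (eigs A)"
  by (simp add: eigs_def)

lemma sorted_nth_neg_iff:
  fixes xs :: "'a::{linorder,zero} list"
  assumes "sorted xs" "i < length xs"
  shows "xs ! i < 0 \<longleftrightarrow> i < length (filter (\<lambda>x. x < 0) xs)"
  using assms
proof (induction xs arbitrary: i)
  case (Cons x xs)
  show ?case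
  proof (cases "x < 0")
    case True
    then show ?thesis using Cons by (cases i) auto
  next
    case False
    then have all: "\<forall>y\<in>set (x # xs). \<not> y < 0" using Cons.prems by auto
    then have "filter (\<lambda>y. y < 0) (x # xs) = []" by (simp only: filter_empty_conv)
    moreover have "\<not> (x # xs) ! i < 0" using all nth_mem [OF Cons.prems(2)] by blast
    ultimately show ?thesis by (metis list.size(3) not_less_zero)
  qed
qed simp

lemma distinct_filter_nth:
  "distinct (filter P xs) \<Longrightarrow> i < length xs \<Longrightarrow> j < length xs \<Longrightarrow> P (xs ! i) \<Longrightarrow> xs ! i = xs ! j \<Longrightarrow> i = j"
proof (induction xs arbitrary: i j)
  case (Cons x xs)
  have "x \<notin> set (filter P xs)" if "P x" using Cons.prems(1) that by simp
  then show ?case using Cons.prems Cons.IH [of "i - 1" "j - 1"]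
    by (cases i; cases j) (auto split: if_splits)
qed simp

lemma first_cols_sqrt_Lambda:
  assumes A: "A \<in> carrier_mat n n" and V: "V \<in> carrier_mat n n" and q: "q \<le> n"
    and "a < n" "i < q"
  shows "(first_cols q V * map_mat sqrt (- leading_principal q (Lambda A))) $$ (a, i)
    = V $$ (a, i) * sqrt (- (eigs A ! i))"
proof -
  have "diagonal_mat (map_mat sqrt (- leading_principal q (Lambda A)))"
    using A q by (auto simp: diagonal_mat_def leading_principal_def Lambda_index)
  then show ?thesis
    using index_mult_diagonal [of "first_cols q V" n q "map_mat sqrt (- leading_principal q (Lambda A))" a i] assms
    by (simp add: first_cols_def leading_principal_def Lambda_index)
qed

lemma index_mult_permutation:
  fixes M :: "real mat"
  assumes "M \<in> carrier_mat n q" "p \<le> q" "a < n" "j < p" "\<sigma> j < q"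
  shows "(M * first_cols p (mat q q (\<lambda>(i, j). if i = \<sigma> j then 1 else 0))) $$ (a, j) = M $$ (a, \<sigma> j)"
proof -
  have "(M * first_cols p (mat q q (\<lambda>(i, j). if i = \<sigma> j then 1 else 0))) $$ (a, j)
      = (\<Sum>i<q. M $$ (a, i) * (if i = \<sigma> j then 1 else 0))"
    using assms by (simp add: first_cols_def scalar_prod_def atLeast0LessThan)
  also have "\<dots> = (\<Sum>i<q. if i = \<sigma> j then M $$ (a, \<sigma> j) else 0)"
    by (intro sum.cong refl) auto
  finally show ?thesis using assms by simp
qed

text \<open>The permutation factor selects column \<open>\<sigma> j\<close> and the diagonal factor
  scales it, which turns the matrix product into a condition on single columns.\<close>

lemma fixed_form_iff:
  assumes A: "A \<in> carrier_mat n n" and V: "V \<in> carrier_mat n n" and X: "X \<in> carrier_mat n p"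
    and q: "q = num_neg_eigs A" and pq: "p \<le> q" and qn: "q \<le> n"
  shows "fixed_form A p V X \<longleftrightarrow> (\<exists>\<sigma> s. \<sigma> permutes {..<q} \<and> (\<forall>j<p. s j \<in> {0, 1, -1}) \<and>
    (\<forall>j<p. \<forall>a<n. column X j a = s j * sqrt (- (eigs A ! \<sigma> j)) * column V (\<sigma> j) a))"
    (is "_ \<longleftrightarrow> ?R")
proof -
  let ?M = "first_cols q V * map_mat sqrt (- leading_principal q (Lambda A))"
  let ?Q = "\<lambda>\<sigma>. mat q q (\<lambda>(i, j). if i = \<sigma> j then 1 else 0) :: real mat"
  have M: "?M \<in> carrier_mat n q"
    using V by (auto simp: first_cols_def leading_principal_def)
  have entry: "(?M * first_cols p (?Q \<sigma>) * S) $$ (a, j)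
      = S $$ (j, j) * sqrt (- (eigs A ! \<sigma> j)) * column V (\<sigma> j) a"
    if \<sigma>: "\<sigma> permutes {..<q}" and S: "diagonal_with_entries p E S" and aj: "a < n" "j < p" for \<sigma> S E a j
  proof -
    have \<sigma>j: "\<sigma> j < q" using permutes_in_image [OF \<sigma>, of j] aj pq by simp
    have "?M * first_cols p (?Q \<sigma>) \<in> carrier_mat n p"
      using M by (auto simp: first_cols_def)
    then have "(?M * first_cols p (?Q \<sigma>) * S) $$ (a, j) = (?M * first_cols p (?Q \<sigma>)) $$ (a, j) * S $$ (j, j)"
      using S aj by (intro index_mult_diagonal) (auto simp: diagonal_with_entries_def)
    also have "(?M * first_cols p (?Q \<sigma>)) $$ (a, j) = V $$ (a, \<sigma> j) * sqrt (- (eigs A ! \<sigma> j))"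
      unfolding index_mult_permutation [where j = j and \<sigma> = \<sigma>, OF M pq aj \<sigma>j]
      by (rule first_cols_sqrt_Lambda [OF A V qn aj(1) \<sigma>j])
    finally show ?thesis by (simp add: column_def)
  qed
  have dim: "?M * first_cols p (?Q \<sigma>) * S \<in> carrier_mat n p" if "diagonal_with_entries p E S" for \<sigma> S E
  proof -
    have "first_cols p (?Q \<sigma>) \<in> carrier_mat q p" by (simp add: first_cols_def)
    moreover have "S \<in> carrier_mat p p" using that by (simp add: diagonal_with_entries_def)
    ultimately show ?thesis by (rule mult_carrier_mat [OF mult_carrier_mat [OF M]])
  qed
  show ?thesis
  proof
    assume "fixed_form A p V X"
    then obtain \<sigma> S where \<sigma>: "\<sigma> permutes {..<q}" and S: "diagonal_with_entries p {0, 1, -1} S"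
      and XM: "X = ?M * first_cols p (?Q \<sigma>) * S"
      unfolding fixed_form_def Let_def permutation_matrix_def q by blast
    have "column X j a = S $$ (j, j) * sqrt (- (eigs A ! \<sigma> j)) * column V (\<sigma> j) a" if "j < p" "a < n" for j a
      using entry [OF \<sigma> S that(2,1)] unfolding XM [symmetric] by (simp add: column_def)
    moreover have "\<forall>j<p. S $$ (j, j) \<in> {0, 1, -1}" using S by (simp add: diagonal_with_entries_def)
    ultimately show ?R using \<sigma> by (intro exI [of _ \<sigma>] exI [of _ "\<lambda>j. S $$ (j, j)"]) simp
  next
    assume ?R
    then obtain \<sigma> s where \<sigma>: "\<sigma> permutes {..<q}" and s: "\<forall>j<p. s j \<in> {0, 1, -1}"
      and Xs: "\<forall>j<p. \<forall>a<n. column X j a = s j * sqrt (- (eigs A ! \<sigma> j)) * column V (\<sigma> j) a" by blast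
    define S where "S = mat p p (\<lambda>(i, j). if i = j then s i else 0)"
    have S: "diagonal_with_entries p {0, 1, -1} S"
      using s by (simp add: diagonal_with_entries_def S_def diagonal_mat_def)
    have "X = ?M * first_cols p (?Q \<sigma>) * S"
    proof (rule eq_matI)
      show "dim_row X = dim_row (?M * first_cols p (?Q \<sigma>) * S)"
        "dim_col X = dim_col (?M * first_cols p (?Q \<sigma>) * S)"
        using dim [OF S] X by (metis carrier_matD)+
      fix a j assume "a < dim_row (?M * first_cols p (?Q \<sigma>) * S)" "j < dim_col (?M * first_cols p (?Q \<sigma>) * S)"
      then have "a < n" "j < p" using dim [OF S] by (metis carrier_matD)+
      then show "X $$ (a, j) = (?M * first_cols p (?Q \<sigma>) * S) $$ (a, j)"
        unfolding entry [OF \<sigma> S \<open>a < n\<close> \<open>j < p\<close>] using Xs by (simp add: S_def column_def)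
    qed
    moreover have "permutation_matrix q (?Q \<sigma>)" using \<sigma> by (auto simp: permutation_matrix_def)
    ultimately show "fixed_form A p V X"
      unfolding fixed_form_def Let_def q [symmetric] using S by blast
  qed
qed

lemma stable_form_iff:
  assumes A: "A \<in> carrier_mat n n" and V: "V \<in> carrier_mat n n" and X: "X \<in> carrier_mat n p"
    and pn: "p \<le> n"
  shows "stable_form A p V X \<longleftrightarrow> (\<exists>s. (\<forall>j<p. s j \<in> {1, -1}) \<and>
    (\<forall>j<p. \<forall>a<n. column X j a = s j * sqrt (- (eigs A ! j)) * column V j a))"
    (is "_ \<longleftrightarrow> ?R")
proof -
  let ?M = "first_cols p V * map_mat sqrt (- leading_principal p (Lambda A))"
  have M: "?M \<in> carrier_mat n p"
    using V by (auto simp: first_cols_def leading_principal_def)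
  have entry: "(?M * S) $$ (a, j) = S $$ (j, j) * sqrt (- (eigs A ! j)) * column V j a"
    if S: "diagonal_with_entries p E S" and aj: "a < n" "j < p" for S E a j
  proof -
    have "(?M * S) $$ (a, j) = ?M $$ (a, j) * S $$ (j, j)"
      using S aj M by (intro index_mult_diagonal) (auto simp: diagonal_with_entries_def)
    then show ?thesis
      unfolding first_cols_sqrt_Lambda [OF A V pn aj] by (simp add: column_def)
  qed
  have dim: "?M * S \<in> carrier_mat n p" if "diagonal_with_entries p E S" for S E
    using M that by (auto simp: diagonal_with_entries_def)
  show ?thesis
  proof
    assume "stable_form A p V X"
    then obtain S where S: "diagonal_with_entries p {1, -1} S" and XM: "X = ?M * S"
      unfolding stable_form_def by blast
    have "column X j a = S $$ (j, j) * sqrt (- (eigs A ! j)) * column V j a" if "j < p" "a < n" for j a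
      using entry [OF S that(2,1)] unfolding XM [symmetric] by (simp add: column_def)
    moreover have "\<forall>j<p. S $$ (j, j) \<in> {1, -1}" using S by (simp add: diagonal_with_entries_def)
    ultimately show ?R by (intro exI [of _ "\<lambda>j. S $$ (j, j)"]) simp
  next
    assume ?R
    then obtain s where s: "\<forall>j<p. s j \<in> {1, -1}"
      and Xs: "\<forall>j<p. \<forall>a<n. column X j a = s j * sqrt (- (eigs A ! j)) * column V j a" by blast
    define S where "S = mat p p (\<lambda>(i, j). if i = j then s i else 0)"
    have S: "diagonal_with_entries p {1, -1} S"
      using s by (simp add: diagonal_with_entries_def S_def diagonal_mat_def)
    have "X = ?M * S"
    proof (rule eq_matI)
      show "dim_row X = dim_row (?M * S)" "dim_col X = dim_col (?M * S)"
        using dim [OF S] X by (metis carrier_matD)+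
      fix a j assume "a < dim_row (?M * S)" "j < dim_col (?M * S)"
      then have "a < n" "j < p" using dim [OF S] by (metis carrier_matD)+
      then show "X $$ (a, j) = (?M * S) $$ (a, j)"
        unfolding entry [OF S \<open>a < n\<close> \<open>j < p\<close>] using Xs by (simp add: S_def column_def)
    qed
    then show "stable_form A p V X"
      unfolding stable_form_def using S by blast
  qed
qed

lemma g1_carrier: "A \<in> carrier_mat n n \<Longrightarrow> X \<in> carrier_mat n p \<Longrightarrow> g1 A X \<in> carrier_mat n p"
  by (auto simp: g1_def triu_def)

lemma g1_index:
  assumes A: "A \<in> carrier_mat n n" and X: "X \<in> carrier_mat n p" and a: "a < n" and j: "j < p"
  shows "g1 A X $$ (a, j) = mv n (entry A) (column X j) a
    + (\<Sum>i\<le>j. column X i a * ip n (column X i) (column X j))"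
proof -
  have T: "triu (X\<^sup>T * X) \<in> carrier_mat p p" using X by (auto simp: triu_def)
  have "(X * triu (X\<^sup>T * X)) $$ (a, j) = (\<Sum>i<p. column X i a * triu (X\<^sup>T * X) $$ (i, j))"
    using X T a j by (simp add: scalar_prod_def column_def atLeast0LessThan)
  also have "\<dots> = (\<Sum>i<p. if i \<le> j then column X i a * ip n (column X i) (column X j) else 0)"
    by (intro sum.cong refl)
      (use X j in \<open>auto simp: triu_def scalar_prod_def ip_def column_def atLeast0LessThan\<close>)
  also have "\<dots> = (\<Sum>i\<le>j. column X i a * ip n (column X i) (column X j))"
    by (rule sum.mono_neutral_cong_right) (use j in auto)
  finally have "(X * triu (X\<^sup>T * X)) $$ (a, j) = (\<Sum>i\<le>j. column X i a * ip n (column X i) (column X j))" .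
  moreover have "(A * X) $$ (a, j) = mv n (entry A) (column X j) a"
    using A X a j by (simp add: scalar_prod_def mv_def column_def atLeast0LessThan)
  ultimately show ?thesis using A X T a j by (simp add: g1_def)
qed

lemma fixed_point_iff_orthogonal_eigenvectors:
  assumes A: "A \<in> carrier_mat n n" and sym: "A\<^sup>T = A" and X: "X \<in> carrier_mat n p" and "\<alpha> > 0"
  shows "fixed_point \<alpha> A X \<longleftrightarrow> orthogonal_eigenvectors n p (entry A) (column X)"
proof -
  have "g1 A X = 0\<^sub>m n p \<longleftrightarrow> (\<forall>j<p. \<forall>a<n. mv n (entry A) (column X j) a
      + (\<Sum>i\<le>j. column X i a * ip n (column X i) (column X j)) = 0)"
    using g1_carrier [OF A X] by (auto simp: mat_eq_iff g1_index [OF A X])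
  also have "\<dots> \<longleftrightarrow> orthogonal_eigenvectors n p (entry A) (column X)"
    by (rule stationary_iff_orthogonal_eigenvectors)
      (metis A sym carrier_matD index_transpose_mat(1))
  finally show ?thesis
    using fixed_point_iff_g1_zero [OF A X \<open>\<alpha> > 0\<close>] by simp
qed


section \<open>The spectrum of the Jacobian matrix\<close>

definition unit_fun :: "nat \<Rightarrow> nat \<Rightarrow> nat \<Rightarrow> nat \<Rightarrow> 'a::zero_neq_one" where
  "unit_fun n r j a = (if a + j * n = r then 1 else 0)"

lemma index_less_mult: "a < n \<Longrightarrow> j < p \<Longrightarrow> a + j * n < n * (p::nat)"
proof -
  assume "a < n" "j < p"
  then have "a + j * n < Suc j * n" by simp
  also have "\<dots> \<le> p * n" using \<open>j < p\<close> by (intro mult_le_mono1) simp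
  finally show ?thesis by (simp add: mult.commute)
qed

text \<open>A column of the Jacobian is the derivative along one unit direction. Along that line the
  entry of \<open>g1\<close> is the polynomial in \<open>t\<close> whose derivative at 0 is known,
  which fixes the value of \<open>deriv\<close>.\<close>

lemma Dg1_index:
  assumes A: "A \<in> carrier_mat n n" and X: "X \<in> carrier_mat n p"
  shows "Dg1 A X \<in> carrier_mat (n * p) (n * p)"
    and "a < n \<Longrightarrow> j < p \<Longrightarrow> s < n * p \<Longrightarrow>
      Dg1 A X $$ (a + j * n, s) = g1_deriv n (entry A) (column X) (unit_fun n s) j a"
proof -
  let ?F = "\<lambda>v. vectorize (g1 A (unvectorize (dim_row X) (dim_col X) v))"
  have F: "?F v = vec (n * p) (\<lambda>k. g1 A (unvectorize n p v) $$ (k mod n, k div n))" for v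
    using X g1_carrier [OF A, of "unvectorize n p v" p]
    by (auto simp: vectorize_def unvectorize_def)
  have X': "dim_vec (vectorize X) = n * p" using X by (simp add: vectorize_def)
  show "Dg1 A X \<in> carrier_mat (n * p) (n * p)"
    unfolding Dg1_def jacobian_mat_def F X' by simp
  assume a: "a < n" and j: "j < p" and s: "s < n * p"
  note k = index_less_mult [OF a j]
  have "Dg1 A X $$ (a + j * n, s)
      = deriv (\<lambda>t. g1 A (unvectorize n p (vectorize X + t \<cdot>\<^sub>v unit_vec (n * p) s)) $$ (a, j)) 0"
    unfolding Dg1_def jacobian_mat_def F X' using k s a by simp
  also have "(\<lambda>t. g1 A (unvectorize n p (vectorize X + t \<cdot>\<^sub>v unit_vec (n * p) s)) $$ (a, j))
    = (\<lambda>t. mv n (entry A) (\<lambda>b. column X j b + t * unit_fun n s j b) a +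
      (\<Sum>i\<le>j. (column X i a + t * unit_fun n s i a) *
        ip n (\<lambda>b. column X i b + t * unit_fun n s i b) (\<lambda>b. column X j b + t * unit_fun n s j b)))"
  proof
    fix t
    let ?Y = "unvectorize n p (vectorize X + t \<cdot>\<^sub>v unit_vec (n * p) s)"
    have Yc: "?Y \<in> carrier_mat n p" by (simp add: unvectorize_def)
    have Y: "column ?Y i b = column X i b + t * unit_fun n s i b" if "b < n" "i < p" for i b
      using that index_less_mult [OF that] X s
      by (auto simp: column_def unvectorize_def vectorize_def unit_fun_def)
    have "mv n (entry A) (column ?Y j) a = mv n (entry A) (\<lambda>b. column X j b + t * unit_fun n s j b) a"
      by (rule mv_cong) (simp add: Y j)
    moreover have "ip n (column ?Y i) (column ?Y j)
        = ip n (\<lambda>b. column X i b + t * unit_fun n s i b) (\<lambda>b. column X j b + t * unit_fun n s j b)"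
      if "i \<le> j" for i
      by (rule ip_cong) (use that j in \<open>simp_all add: Y\<close>)
    ultimately show "g1 A ?Y $$ (a, j) = mv n (entry A) (\<lambda>b. column X j b + t * unit_fun n s j b) a +
      (\<Sum>i\<le>j. (column X i a + t * unit_fun n s i a) *
        ip n (\<lambda>b. column X i b + t * unit_fun n s i b) (\<lambda>b. column X j b + t * unit_fun n s j b))"
      unfolding g1_index [OF A Yc a j] using j a by (simp add: Y)
  qed
  also have "deriv \<dots> 0 = g1_deriv n (entry A) (column X) (unit_fun n s) j a"
    by (rule DERIV_imp_deriv [OF has_field_derivative_g1_deriv])
  finally show "Dg1 A X $$ (a + j * n, s) = g1_deriv n (entry A) (column X) (unit_fun n s) j a" .
qed

text \<open>By linearity the matrix applied to a vector is the derivative in the direction unfolded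
  from it. The field is left open because instability refers to the real spectrum and stability to
  the complex one.\<close>

lemma eigenvalue_Dg1_iff:
  fixes z :: "'a::real_normed_field"
  assumes A: "A \<in> carrier_mat n n" and X: "X \<in> carrier_mat n p"
  shows "eigenvalue (map_mat of_real (Dg1 A X)) z \<longleftrightarrow>
    (\<exists>E. (\<exists>j<p. \<exists>a<n. E j a \<noteq> 0) \<and>
      (\<forall>j<p. \<forall>a<n. g1_deriv n (\<lambda>a b. of_real (A $$ (a, b))) (\<lambda>j a. of_real (column X j a)) E j a = z * E j a))"
    (is "_ \<longleftrightarrow> (\<exists>E. ?P E)")
proof -
  let ?g1_deriv = "g1_deriv n (\<lambda>a b. of_real (A $$ (a, b))) (\<lambda>j a. of_real (column X j a)) :: _ \<Rightarrow> _ \<Rightarrow> _ \<Rightarrow> 'a"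
  let ?M = "map_mat of_real (Dg1 A X) :: 'a mat"
  let ?E = "\<lambda>v j a. v $ (a + j * n) :: 'a"
  have M: "?M \<in> carrier_mat (n * p) (n * p)" using Dg1_index(1) [OF A X] by simp
  have Mv: "(?M *\<^sub>v v) $ (a + j * n) = ?g1_deriv (?E v) j a"
    if v: "v \<in> carrier_vec (n * p)" and a: "a < n" and j: "j < p" for v a j
  proof -
    have "(?M *\<^sub>v v) $ (a + j * n) = (\<Sum>s<n * p. v $ s * of_real (Dg1 A X $$ (a + j * n, s)))"
      using M v index_less_mult [OF a j]
      by (simp add: scalar_prod_def atLeast0LessThan mult.commute)
    also have "\<dots> = (\<Sum>s<n * p. v $ s * ?g1_deriv (\<lambda>j a. of_real (unit_fun n s j a)) j a)"
      by (intro sum.cong refl) (simp only: g1_deriv_of_real Dg1_index(2) [OF A X a j] lessThan_iff)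
    also have "\<dots> = ?g1_deriv (\<lambda>j a. \<Sum>s<n * p. v $ s * of_real (unit_fun n s j a)) j a"
      by (rule g1_deriv_sum [symmetric])
    also have "\<dots> = ?g1_deriv (?E v) j a"
    proof (rule g1_deriv_cong)
      fix i b assume "i \<le> j" "b < n"
      then have "b + i * n < n * p" using j by (intro index_less_mult) auto
      moreover have "(\<Sum>s<n * p. v $ s * of_real (unit_fun n s i b)) = (\<Sum>s<n * p. if s = b + i * n then v $ s else 0)"
        by (intro sum.cong refl) (auto simp: unit_fun_def)
      ultimately show "(\<Sum>s<n * p. v $ s * of_real (unit_fun n s i b)) = v $ (b + i * n)" by simp
    qed (rule a)
    finally show ?thesis .
  qed
  have coord: "\<exists>a j. a < n \<and> j < p \<and> r = a + j * n" if "r < n * p" for r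
  proof -
    have "n > 0" using that by (cases n) auto
    then have "r mod n < n" "r div n < p" "r = r mod n + (r div n) * n"
      using that by (simp_all add: less_mult_imp_div_less mult.commute)
    then show ?thesis by blast
  qed
  have vec_eq: "v = w \<longleftrightarrow> (\<forall>j<p. \<forall>a<n. v $ (a + j * n) = w $ (a + j * n))"
    if "v \<in> carrier_vec (n * p)" "w \<in> carrier_vec (n * p)" for v w :: "'a vec"
  proof
    assume R: "\<forall>j<p. \<forall>a<n. v $ (a + j * n) = w $ (a + j * n)"
    show "v = w"
    proof (rule eq_vecI)
      fix r assume "r < dim_vec w"
      then have "r < n * p" using that by simp
      then obtain a j where "a < n" "j < p" "r = a + j * n" using coord by blast
      then show "v $ r = w $ r" using R by simp
    qed (use that in auto)
  qed simp
  have ev: "eigenvector ?M v z \<longleftrightarrow> ?P (?E v)" if v: "v \<in> carrier_vec (n * p)" for v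
  proof -
    have "v \<noteq> 0\<^sub>v (n * p) \<longleftrightarrow> (\<exists>j<p. \<exists>a<n. ?E v j a \<noteq> 0)"
      using vec_eq [OF v, of "0\<^sub>v (n * p)"] index_less_mult by auto
    moreover have "?M *\<^sub>v v = z \<cdot>\<^sub>v v \<longleftrightarrow> (\<forall>j<p. \<forall>a<n. ?g1_deriv (?E v) j a = z * ?E v j a)"
      using vec_eq [of "?M *\<^sub>v v" "z \<cdot>\<^sub>v v"] M v Mv [OF v] index_less_mult [of _ n _ p] by auto
    ultimately show ?thesis using M v by (simp add: eigenvector_def)
  qed
  show ?thesis
  proof
    assume "eigenvalue ?M z"
    then obtain v where v: "eigenvector ?M v z" unfolding eigenvalue_def by blast
    then have "v \<in> carrier_vec (n * p)" using M by (auto simp: eigenvector_def)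
    from ev [OF this] v have "?P (?E v)" by (rule iffD1)
    then show "\<exists>E. ?P E" by (rule exI [of _ "?E v"])
  next
    assume "\<exists>E. ?P E"
    then obtain E where E: "?P E" by blast
    define v where "v = vec (n * p) (\<lambda>r. E (r div n) (r mod n))"
    have v: "v \<in> carrier_vec (n * p)" by (simp add: v_def)
    have vE: "?E v j a = E j a" if "j < p" "a < n" for j a
      using index_less_mult [OF that(2,1)] that by (simp add: v_def)
    have "?g1_deriv (?E v) j a = ?g1_deriv E j a" if "j < p" "a < n" for j a
      by (rule g1_deriv_cong) (use that vE in auto)
    with E vE have "?P (?E v)" by metis
    then have "eigenvector ?M v z" using ev [OF v] by simp
    then show "eigenvalue ?M z" unfolding eigenvalue_def by blast
  qed
qed


section \<open>Fixed points and stability\<close>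

text \<open>The complements of \<open>J\<close> and of its image have equal size and can be matched
  arbitrarily. This completes the places of the nonzero columns to the full permutation that
  \<open>fixed_form\<close> asks for.\<close>

lemma inj_on_extends_to_permutation:
  assumes S: "finite S" "J \<subseteq> S" and \<sigma>: "inj_on \<sigma> J" "\<sigma> ` J \<subseteq> S"
  obtains \<pi> where "\<pi> permutes S" "\<And>j. j \<in> J \<Longrightarrow> \<pi> j = \<sigma> j"
proof -
  have "card (S - J) = card (S - \<sigma> ` J)"
    using assms finite_subset [OF S(2,1)] by (simp add: card_Diff_subset card_image)
  then obtain \<tau> where \<tau>: "bij_betw \<tau> (S - J) (S - \<sigma> ` J)"
    using finite_same_card_bij [of "S - J" "S - \<sigma> ` J"] S(1) by auto
  define \<pi> where "\<pi> = (\<lambda>j. if j \<in> J then \<sigma> j else if j \<in> S then \<tau> j else j)"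
  have "bij_betw \<pi> J (\<sigma> ` J)"
    using \<sigma>(1) by (subst bij_betw_cong [of _ _ \<sigma>]) (auto simp: \<pi>_def bij_betw_def)
  moreover have "bij_betw \<pi> (S - J) (S - \<sigma> ` J)"
    using \<tau> by (subst bij_betw_cong [of _ _ \<tau>]) (auto simp: \<pi>_def)
  ultimately have "bij_betw \<pi> (J \<union> (S - J)) (\<sigma> ` J \<union> (S - \<sigma> ` J))"
    by (rule bij_betw_combine) auto
  moreover have "J \<union> (S - J) = S" "\<sigma> ` J \<union> (S - \<sigma> ` J) = S" using S \<sigma> by auto
  ultimately have "\<pi> permutes S"
    using S by (intro bij_imp_permutes) (auto simp: \<pi>_def)
  then show thesis by (rule that) (simp add: \<pi>_def)
qed

text \<open>A greedy argument: column \<open>j\<close> must take a smallest eigenvalue among the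
  places left by the columns before it. With ties \<open>\<sigma> j = j\<close> may fail, so
  eigenvalues are compared instead of places. \<open>NU\<close> expresses the absence of negative
  Jacobian eigenvalues.\<close>

lemma smallest_eigenvalues_attained:
  fixes A :: "nat \<Rightarrow> nat \<Rightarrow> real"
  assumes sym: "\<And>a b. a < n \<Longrightarrow> b < n \<Longrightarrow> A a b = A b a"
    and U: "eigenbasis n A l U" and X: "orthogonal_eigenvectors n p A X"
    and mono: "\<And>i j. i \<le> j \<Longrightarrow> j < n \<Longrightarrow> l i \<le> l j"
    and pn: "p \<le> n" and neg: "\<And>k. k < p \<Longrightarrow> l k < 0"
    and NU: "\<And>j u \<kappa>. j < p \<Longrightarrow> \<exists>a<n. u a \<noteq> 0 \<Longrightarrow> (\<And>i. i \<le> j \<Longrightarrow> ip n u (X i) = 0)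
      \<Longrightarrow> (\<And>a. a < n \<Longrightarrow> mv n A u a = \<kappa> * u a) \<Longrightarrow> \<kappa> + ip n (X j) (X j) \<ge> 0"
    and j: "j < p"
  shows "ip n (X j) (X j) = - l j"
proof -
  let ?d = "\<lambda>j. ip n (X j) (X j)"
  let ?J = "\<lambda>m. {i. i < m \<and> ?d i \<noteq> 0}"
  obtain V \<sigma> where V: "eigenbasis n A l V" and inj: "inj_on \<sigma> (?J p)"
    and \<sigma>: "\<And>j. j < p \<Longrightarrow> ?d j \<noteq> 0 \<Longrightarrow> \<sigma> j < n \<and> l (\<sigma> j) = - ?d j"
    and XV: "\<And>j a. j < p \<Longrightarrow> ?d j \<noteq> 0 \<Longrightarrow> a < n \<Longrightarrow> X j a = sqrt (?d j) * V (\<sigma> j) a"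
    by (rule orthogonal_eigenvectors_in_basis [OF sym U X]) auto
  \<comment> \<open>A vector \<open>V k\<close> whose place is not taken by columns
    \<open>0, ..., j\<close> is orthogonal to all of them, so \<open>NU\<close> applies to
    it.\<close>
  have ge: "l k \<ge> - ?d j" if j: "j < p" and k: "k < n" "k \<notin> \<sigma> ` ?J (Suc j)" for j k
  proof -
    have Vk: "ip n (V k) (V k) = 1" using V k by (simp add: eigenbasis_def)
    have "l k + ?d j \<ge> 0"
    proof (rule NU [OF j, of "V k"])
      show "\<exists>a<n. V k a \<noteq> 0" using Vk ip_self_eq_0_iff [of n "V k"] by auto
      show "mv n A (V k) a = l k * V k a" if "a < n" for a
        using V k that by (simp add: eigenbasis_def)
      fix i assume i: "i \<le> j"
      show "ip n (V k) (X i) = 0"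
      proof (cases "?d i = 0")
        case True
        then show ?thesis by (rule ip_self_0_ip)
      next
        case False
        then have "\<sigma> i \<noteq> k" "\<sigma> i < n" using i j k \<sigma> [of i] by auto
        have "ip n (V k) (X i) = ip n (V k) (\<lambda>a. sqrt (?d i) * V (\<sigma> i) a)"
          by (rule ip_cong) (use XV False i j in auto)
        then show ?thesis
          using V k \<open>\<sigma> i \<noteq> k\<close> \<open>\<sigma> i < n\<close> by (simp add: ip_linear eigenbasis_def)
      qed
    qed
    then show ?thesis by simp
  qed
  \<comment> \<open>Pigeonhole: the \<open>j\<close> columns before \<open>j\<close> cannot take all
    \<open>j + 1\<close> places up to \<open>j\<close>.\<close>
  have unused: "\<exists>k\<le>j. k \<notin> \<sigma> ` ?J j" for j
  proof (rule ccontr)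
    assume "\<not> ?thesis"
    then have "card {..j} \<le> card (\<sigma> ` ?J j)" by (intro card_mono) auto
    also have "\<dots> \<le> card (?J j)" by (rule card_image_le) simp
    also have "\<dots> \<le> card {..<j}" by (intro card_mono) auto
    finally show False by simp
  qed
  \<comment> \<open>A zero column takes no place, so some place \<open>k \<le> j\<close> stays free
    after it and \<open>ge\<close> would give \<open>l k \<ge> 0\<close>.\<close>
  have d0: "?d j \<noteq> 0" if j: "j < p" for j
  proof
    assume 0: "?d j = 0"
    then have "?J (Suc j) = ?J j" by (auto simp: less_Suc_eq)
    with unused obtain k where k: "k \<le> j" "k \<notin> \<sigma> ` ?J (Suc j)" by metis
    then have "l k \<ge> 0" using ge [OF j, of k] 0 j pn by simp
    with neg [of k] k j show False by simp
  qed
  have J: "?J m = {..<m}" if "m \<le> p" for m using d0 that by auto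
  \<comment> \<open>Some place \<open>k \<le> j\<close> is free before column \<open>j\<close>;
    either column \<open>j\<close> takes it, or \<open>ge\<close> shows that its eigenvalue is no
    larger than \<open>l k\<close>.\<close>
  have "l (\<sigma> j) \<le> l j"
  proof -
    obtain k where k: "k \<le> j" "k \<notin> \<sigma> ` {..<j}" using unused [of j] J [of j] j by auto
    show ?thesis
    proof (cases "k = \<sigma> j")
      case True
      then show ?thesis using mono [of k j] k j pn by simp
    next
      case False
      then have "k \<notin> \<sigma> ` ?J (Suc j)" using J [of "Suc j"] j k by (auto simp: less_Suc_eq)
      then have "l k \<ge> - ?d j" using ge [OF j] k j pn by simp
      then show ?thesis using \<sigma> [OF j d0 [OF j]] mono [of k j] k j pn by simp
    qed
  qed
  \<comment> \<open>By injectivity some \<open>i \<le> j\<close> has its place at or beyond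
    \<open>j\<close>. If \<open>i < j\<close>, the place of column \<open>j\<close> was still free
    at step \<open>i\<close>, so \<open>l (\<sigma> i) \<le> l (\<sigma> j)\<close>.\<close>
  moreover have "l j \<le> l (\<sigma> j)"
  proof -
    have "\<exists>i\<le>j. \<sigma> i \<ge> j"
    proof (rule ccontr)
      assume "\<not> ?thesis"
      then have "card (\<sigma> ` {..j}) \<le> card {..<j}" by (intro card_mono) auto
      moreover have "card (\<sigma> ` {..j}) = card {..j}"
        by (rule card_image, rule inj_on_subset [OF inj [unfolded J [OF order_refl]]]) (use j in auto)
      ultimately show False by simp
    qed
    then obtain i where i: "i \<le> j" "\<sigma> i \<ge> j" by blast
    have le: "l j \<le> l (\<sigma> i)" using mono [of j "\<sigma> i"] i \<sigma> [of i] d0 [of i] j by simp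
    show ?thesis
    proof (cases "i = j")
      case False
      have "\<sigma> j \<notin> \<sigma> ` ?J (Suc i)"
      proof
        assume "\<sigma> j \<in> \<sigma> ` ?J (Suc i)"
        then obtain m where m: "m < Suc i" "\<sigma> j = \<sigma> m" by blast
        then have "j = m"
          using inj_onD [OF inj [unfolded J [OF order_refl]], of j m] i j by simp
        with m(1) i(1) False show False by simp
      qed
      then have "l (\<sigma> j) \<ge> - ?d i"
        using ge [of i "\<sigma> j"] \<sigma> [of j] d0 [of j] i j by simp
      then show ?thesis using le \<sigma> [of i] d0 [of i] i j by simp
    qed (use le in simp)
  qed
  ultimately show ?thesis using \<sigma> [OF j d0 [OF j]] by simp
qed

lemma eigenbasis_cong:
  assumes "\<And>k a. k < n \<Longrightarrow> a < n \<Longrightarrow> V k a = W k a" and V: "eigenbasis n A l V"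
  shows "eigenbasis n A l W"
proof -
  have "mv n A (W k) a = mv n A (V k) a" if "k < n" for k a
    by (rule mv_cong) (use assms that in auto)
  moreover have "ip n (W k) (W m) = ip n (V k) (V m)" if "k < n" "m < n" for k m
    by (rule ip_cong) (use assms that in auto)
  ultimately show ?thesis using assms by (simp add: eigenbasis_def)
qed

lemma eigenbasis_of_real:
  assumes "eigenbasis n A l V"
  shows "eigenbasis n (\<lambda>a b. of_real (A a b)) (\<lambda>k. of_real (l k))
    (\<lambda>k a. of_real (V k a) :: 'a::{comm_ring_1,real_algebra_1})"
proof -
  have "mv n (\<lambda>a b. of_real (A a b)) (\<lambda>a. of_real (V k a)) a = (of_real (mv n A (V k) a) :: 'a)" for k a
    by (simp add: mv_def)
  moreover have "ip n (\<lambda>a. of_real (V k a)) (\<lambda>a. of_real (V m a)) = (of_real (ip n (V k) (V m)) :: 'a)" for k m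
    by (simp add: ip_def)
  ultimately show ?thesis using assms by (simp add: eigenbasis_def)
qed

lemma map_mat_of_real_id: "map_mat of_real M = (M :: real mat)"
  by (rule eq_matI) auto

locale symmetric_iteration =
  fixes A U X :: "real mat" and n p q :: nat and \<alpha> :: real
  assumes A: "A \<in> carrier_mat n n" and sym: "A\<^sup>T = A"
    and q: "q = num_neg_eigs A" and p: "p \<le> q"
    and \<alpha>: "\<alpha> > 0"
    and U: "diagonalizer A U"
    and X: "X \<in> carrier_mat n p"
begin

abbreviation l :: "nat \<Rightarrow> real" where "l i \<equiv> eigs A ! i"
abbreviation d :: "nat \<Rightarrow> real" where "d j \<equiv> ip n (column X j) (column X j)"

lemma entry_symmetric: "a < n \<Longrightarrow> b < n \<Longrightarrow> entry A a b = entry A b a"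
  using A sym by (metis carrier_matD index_transpose_mat(1))

lemma length_eigs_n: "length (eigs A) = n"
  by (rule length_eigs [OF A U])

lemma qn: "q \<le> n"
  using length_eigs_n length_filter_le unfolding q num_neg_eigs_def by metis

lemma pn: "p \<le> n"
  using p qn by simp

lemma l_mono: "i \<le> j \<Longrightarrow> j < n \<Longrightarrow> l i \<le> l j"
  using sorted_eigs [of A] length_eigs_n by (simp add: sorted_nth_mono)

lemma l_neg: "k < n \<Longrightarrow> l k < 0 \<longleftrightarrow> k < q"
  using sorted_nth_neg_iff [OF sorted_eigs, of k A] length_eigs_n by (simp add: q num_neg_eigs_def)

lemma diagonalizerD:
  assumes "diagonalizer A V"
  shows "V \<in> carrier_mat n n" "eigenbasis n (entry A) l (column V)"
  using assms by (simp_all add: diagonalizer_iff_eigenbasis [OF A])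

lemma eigenbasis_diagonalizer:
  assumes "eigenbasis n (entry A) l V"
  obtains W where "diagonalizer A W" "\<And>k a. k < n \<Longrightarrow> a < n \<Longrightarrow> column W k a = V k a"
proof -
  define W where "W = mat n n (\<lambda>(a, k). V k a)"
  have W: "W \<in> carrier_mat n n" "\<And>k a. k < n \<Longrightarrow> a < n \<Longrightarrow> column W k a = V k a"
    by (simp_all add: W_def column_def)
  then have "eigenbasis n (entry A) l (column W)"
    by (intro eigenbasis_cong [OF _ assms]) simp
  with W that show thesis by (simp add: diagonalizer_iff_eigenbasis [OF A])
qed

lemma fixed_point_iff:
  "fixed_point \<alpha> A X \<longleftrightarrow> orthogonal_eigenvectors n p (entry A) (column X)"
  by (rule fixed_point_iff_orthogonal_eigenvectors [OF A sym X \<alpha>])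

section \<open>Fixed points and matrices in \<open>fixed_form\<close>\<close>

lemma fixed_form_imp_fixed_point:
  assumes V: "diagonalizer A V" and "fixed_form A p V X"
  shows "fixed_point \<alpha> A X"
proof -
  obtain \<sigma> s where \<sigma>: "\<sigma> permutes {..<q}" and s: "\<forall>j<p. s j \<in> {0, 1, -1}"
    and XV: "\<forall>j<p. \<forall>a<n. column X j a = s j * sqrt (- l (\<sigma> j)) * column V (\<sigma> j) a"
    using assms(2) unfolding fixed_form_iff [OF A diagonalizerD(1) [OF V] X q p qn] by blast
  have \<sigma>q: "\<sigma> j < q" if "j < p" for j
    using permutes_in_image [OF \<sigma>, of j] that p by simp
  show ?thesis
    unfolding fixed_point_iff
  proof (rule orthogonal_eigenvectors_scaled_basis [OF diagonalizerD(2) [OF V]])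
    show "inj_on \<sigma> {..<p}" using permutes_inj_on [OF \<sigma>] by blast
    show "\<sigma> j < n" if "j < p" for j using \<sigma>q [OF that] qn by simp
    show "column X j a = s j * sqrt (- l (\<sigma> j)) * column V (\<sigma> j) a" if "j < p" "a < n" for j a
      using XV that by blast
    \<comment> \<open>Each \<open>s j\<close> satisfies \<open>s^3 = s\<close>, and the square root
      squares to \<open>- l (\<sigma> j)\<close> because places below \<open>q\<close> have negative
      eigenvalues.\<close>
    show "s j * sqrt (- l (\<sigma> j)) * l (\<sigma> j)
        = - (s j * sqrt (- l (\<sigma> j)) * (s j * sqrt (- l (\<sigma> j))) * (s j * sqrt (- l (\<sigma> j))))" if "j < p" for j
    proof -
      have "l (\<sigma> j) < 0" using l_neg [of "\<sigma> j"] \<sigma>q [OF that] qn by simp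
      then have "sqrt (- l (\<sigma> j)) * sqrt (- l (\<sigma> j)) = - l (\<sigma> j)" by simp
      then show ?thesis using s that by auto
    qed
  qed
qed

lemma fixed_point_imp_fixed_form:
  assumes "fixed_point \<alpha> A X"
  shows "\<exists>V. diagonalizer A V \<and> fixed_form A p V X"
proof -
  let ?J = "{j. j < p \<and> d j \<noteq> 0}"
  obtain V \<sigma> where V: "eigenbasis n (entry A) l V" and inj: "inj_on \<sigma> ?J"
    and \<sigma>: "\<And>j. j < p \<Longrightarrow> d j \<noteq> 0 \<Longrightarrow> \<sigma> j < n \<and> l (\<sigma> j) = - d j"
    and XV: "\<And>j a. j < p \<Longrightarrow> d j \<noteq> 0 \<Longrightarrow> a < n \<Longrightarrow> column X j a = sqrt (d j) * V (\<sigma> j) a"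
    by (rule orthogonal_eigenvectors_in_basis
        [OF entry_symmetric diagonalizerD(2) [OF U] assms [unfolded fixed_point_iff]]) auto
  \<comment> \<open>A nonzero column has the negative eigenvalue \<open>- d j\<close>, and negative
    eigenvalues sit exactly at the places below \<open>q\<close>.\<close>
  have \<sigma>q: "\<sigma> j < q" if "j < p" "d j \<noteq> 0" for j
    using \<sigma> [OF that] l_neg [of "\<sigma> j"] ip_self_nonneg [of n "column X j"] that(2) by simp
  obtain \<pi> where \<pi>: "\<pi> permutes {..<q}" "\<And>j. j \<in> ?J \<Longrightarrow> \<pi> j = \<sigma> j"
    by (rule inj_on_extends_to_permutation [of "{..<q}" ?J \<sigma>]) (use p inj \<sigma>q in auto)
  obtain W where W: "diagonalizer A W" "\<And>k a. k < n \<Longrightarrow> a < n \<Longrightarrow> column W k a = V k a"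
    using eigenbasis_diagonalizer [OF V] by blast
  \<comment> \<open>The adapted basis contains the normalised columns themselves, so every nonzero
    column has sign 1. For a zero column the entry 0 makes the completed value of
    \<open>\<pi> j\<close> harmless.\<close>
  define s where "s = (\<lambda>j. if d j = 0 then 0 else 1 :: real)"
  have "column X j a = s j * sqrt (- l (\<pi> j)) * column W (\<pi> j) a" if "j < p" "a < n" for j a
  proof (cases "d j = 0")
    case True
    then show ?thesis using that ip_self_eq_0_iff [of n "column X j"] by (simp add: s_def)
  next
    case False
    then show ?thesis using \<sigma> [of j] XV [of j a] \<pi>(2) [of j] W(2) [of "\<sigma> j" a] that by (simp add: s_def)
  qed
  then have "fixed_form A p W X"
    unfolding fixed_form_iff [OF A diagonalizerD(1) [OF W(1)] X q p qn]
    using \<pi>(1) by (intro exI [of _ \<pi>] exI [of _ s]) (auto simp: s_def)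
  with W(1) show ?thesis by blast
qed

lemma stable_form_imp_fixed_form:
  assumes V: "diagonalizer A V" and "stable_form A p V X"
  shows "fixed_form A p V X"
proof -
  obtain s where "\<forall>j<p. s j \<in> {1, -1}"
    "\<forall>j<p. \<forall>a<n. column X j a = s j * sqrt (- l j) * column V j a"
    using assms(2) unfolding stable_form_iff [OF A diagonalizerD(1) [OF V] X pn] by blast
  then show ?thesis
    unfolding fixed_form_iff [OF A diagonalizerD(1) [OF V] X q p qn]
    by (intro exI [of _ id] exI [of _ s]) (auto simp: permutes_id)
qed

section \<open>The Jacobian spectrum, instability and \<open>stable_form\<close>\<close>

lemma stable_form_eigenvalue_cases:
  fixes z :: "'b::real_normed_field"
  assumes V: "diagonalizer A V" and "stable_form A p V X"
    and z: "eigenvalue (map_mat of_real (Dg1 A X)) z"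
  obtains j k where "j < p" "k < n"
    "z = of_real (if k < j then - l j else if k = j then - 2 * l j else l k - l j)"
proof -
  obtain s where s: "\<forall>j<p. s j \<in> {1, -1}"
    and XV: "\<forall>j<p. \<forall>a<n. column X j a = s j * sqrt (- l j) * column V j a"
    using assms(2) unfolding stable_form_iff [OF A diagonalizerD(1) [OF V] X pn] by blast
  obtain E :: "nat \<Rightarrow> nat \<Rightarrow> 'b" where E0: "\<exists>j<p. \<exists>a<n. E j a \<noteq> 0"
    and E: "\<forall>j<p. \<forall>a<n. g1_deriv n (\<lambda>a b. of_real (A $$ (a, b))) (\<lambda>j a. of_real (column X j a)) E j a = z * E j a"
    using z unfolding eigenvalue_Dg1_iff [OF A X] by blast
  obtain j k where "j < p" "k < n"
    "z = (if k < j then - of_real (l j) else if k = j then - 2 * of_real (l j) else of_real (l k) - of_real (l j))"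
  proof (rule g1_deriv_eigenvalue_cases [OF _ eigenbasis_of_real [OF diagonalizerD(2) [OF V]] pn _ _ E0])
    show "of_real (entry A a b) = (of_real (entry A b a) :: 'b)" if "a < n" "b < n" for a b
      using entry_symmetric [OF that] by simp
    show "of_real (column X j a) = of_real (s j * sqrt (- l j)) * (of_real (column V j a) :: 'b)"
      if "j < p" "a < n" for j a
      using XV that by simp
    show "of_real (s j * sqrt (- l j)) * of_real (s j * sqrt (- l j)) = - (of_real (l j) :: 'b)" if "j < p" for j
    proof -
      have "l j < 0" using l_neg [of j] that p qn by simp
      then have "s j * sqrt (- l j) * (s j * sqrt (- l j)) = - l j" using s that by auto
      then show ?thesis by (metis of_real_minus of_real_mult)
    qed
    show "g1_deriv n (\<lambda>a b. of_real (entry A a b)) (\<lambda>j a. of_real (column X j a)) E j a = z * E j a"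
      if "j < p" "a < n" for j a using E that by blast
  qed (rule that)
  then show thesis by (intro that [of j k]) auto
qed

text \<open>Two uses: a negative value over the reals proves instability, and the value 0 over the
  complex numbers refutes stability.\<close>

lemma eigenvalue_of_eigenvector:
  assumes "fixed_point \<alpha> A X" and j: "j < p"
    and u0: "\<exists>a<n. u a \<noteq> 0"
    and uX: "\<And>i. i \<le> j \<Longrightarrow> ip n u (column X i) = 0"
    and Au: "\<And>a. a < n \<Longrightarrow> mv n (entry A) u a = \<kappa> * u a"
    and \<kappa>: "\<kappa> + d j \<le> 0"
  shows "eigenvalue (map_mat of_real (Dg1 A X) :: 'b::real_normed_field mat) (of_real (\<kappa> + d j))"
proof -
  obtain E where Ej: "E j = u" and
    E: "\<And>l a. l < p \<Longrightarrow> a < n \<Longrightarrow> g1_deriv n (entry A) (column X) E l a = (\<kappa> + d j) * E l a"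
    using g1_deriv_real_eigenvector [OF assms(1) [unfolded fixed_point_iff] j uX Au \<kappa>] by blast
  have "\<exists>j<p. \<exists>a<n. (of_real (E j a) :: 'b) \<noteq> 0"
    using j u0 Ej by auto
  moreover have "\<forall>j'<p. \<forall>a<n. g1_deriv n (\<lambda>a b. of_real (A $$ (a, b))) (\<lambda>j a. of_real (column X j a))
      (\<lambda>j a. of_real (E j a)) j' a = of_real (\<kappa> + d j) * (of_real (E j' a) :: 'b)"
    by (simp add: g1_deriv_of_real E)
  ultimately show ?thesis
    unfolding eigenvalue_Dg1_iff [OF A X] by (intro exI [of _ "\<lambda>j a. of_real (E j a)"] conjI)
qed

lemma not_unstable_imp_stable_form:
  assumes f: "fixed_point \<alpha> A X" and nu: "\<not> unstable_fixed_point \<alpha> A X"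
  shows "\<exists>V. diagonalizer A V \<and> stable_form A p V X"
proof -
  have NU: "\<kappa> + d j \<ge> 0" if "j < p" "\<exists>a<n. u a \<noteq> 0" "\<And>i. i \<le> j \<Longrightarrow> ip n u (column X i) = 0"
    "\<And>a. a < n \<Longrightarrow> mv n (entry A) u a = \<kappa> * u a" for j u \<kappa>
  proof (rule ccontr)
    assume neg: "\<not> \<kappa> + d j \<ge> 0"
    then have "eigenvalue (map_mat of_real (Dg1 A X) :: real mat) (of_real (\<kappa> + d j))"
      by (intro eigenvalue_of_eigenvector [OF f that]) auto
    with neg nu f show False
      unfolding unstable_fixed_point_def map_mat_of_real_id by (auto simp: not_le)
  qed
  have o: "orthogonal_eigenvectors n p (entry A) (column X)" using f fixed_point_iff by simp
  have dl: "d j = - l j" if "j < p" for j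
    by (rule smallest_eigenvalues_attained [OF entry_symmetric diagonalizerD(2) [OF U] o l_mono pn _ NU that])
      (use l_neg p qn in auto)
  have neg: "l j < 0" if "j < p" for j using l_neg [of j] that p qn by simp
  \<comment> \<open>By \<open>dl\<close> the length of column \<open>j\<close> is
    \<open>sqrt (- l j)\<close>, so these are the normalised columns, with the eigenvalues of the
    first \<open>p\<close> places.\<close>
  define u where "u = (\<lambda>j a. 1 / sqrt (- l j) * column X j a)"
  obtain V where V: "eigenbasis n (entry A) l V" "\<And>j a. j < p \<Longrightarrow> a < n \<Longrightarrow> V j a = u j a"
  proof (rule eigenbasis_extending [OF entry_symmetric diagonalizerD(2) [OF U] pn, of u])
    show "ip n (u i) (u j) = (if i = j then 1 else 0)" if "i < p" "j < p" for i j
    proof (cases "i = j")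
      case True
      then show ?thesis unfolding u_def ip_linear using dl [OF that(2)] neg [OF that(2)]
        by (simp add: field_simps)
    next
      case False
      then show ?thesis unfolding u_def ip_linear using o that
        by (simp add: orthogonal_eigenvectors_def)
    qed
    show "mv n (entry A) (u j) a = l j * u j a" if "j < p" "a < n" for j a
      unfolding u_def mv_scale using o that dl [OF that(1)] by (simp add: orthogonal_eigenvectors_def)
  qed auto
  obtain W where W: "diagonalizer A W" "\<And>k a. k < n \<Longrightarrow> a < n \<Longrightarrow> column W k a = V k a"
    using eigenbasis_diagonalizer [OF V(1)] by blast
  have "column X j a = 1 * sqrt (- l j) * column W j a" if "j < p" "a < n" for j a
    using W(2) [of j a] V(2) [OF that] that pn neg [OF that(1)] by (simp add: u_def)
  then have "stable_form A p W X"
    unfolding stable_form_iff [OF A diagonalizerD(1) [OF W(1)] X pn]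
    by (intro exI [of _ "\<lambda>_. 1"]) auto
  with W(1) show ?thesis by blast
qed

text \<open>As \<open>l j < 0\<close> and the eigenvalues are sorted, every value in the case list
  is nonnegative. It may be 0 at a tie, so this argument does not give stability.\<close>

lemma stable_form_not_unstable:
  assumes "diagonalizer A V" "stable_form A p V X"
  shows "\<not> unstable_fixed_point \<alpha> A X"
proof
  assume "unstable_fixed_point \<alpha> A X"
  then obtain x where x: "x < 0" "eigenvalue (Dg1 A X) x"
    unfolding unstable_fixed_point_def by blast
  then have ev: "eigenvalue (map_mat of_real (Dg1 A X)) x"
    by (simp only: map_mat_of_real_id)
  obtain j k where jk: "j < p" "k < n"
    "x = of_real (if k < j then - l j else if k = j then - 2 * l j else l k - l j)"
    by (rule stable_form_eigenvalue_cases [OF assms ev])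
  moreover have "l j < 0" using l_neg [of j] jk(1) p qn by simp
  ultimately show False using x(1) l_mono [of j k] by (auto split: if_splits)
qed

lemma unstable_iff:
  "unstable_fixed_point \<alpha> A X \<longleftrightarrow>
    fixed_point \<alpha> A X \<and> \<not> (\<exists>V. diagonalizer A V \<and> stable_form A p V X)"
  using not_unstable_imp_stable_form stable_form_not_unstable
  by (auto simp: unstable_fixed_point_def)

lemma stable_imp_not_unstable:
  assumes "stable_fixed_point \<alpha> A X"
  shows "\<not> unstable_fixed_point \<alpha> A X"
proof
  assume "unstable_fixed_point \<alpha> A X"
  then obtain x where "x < 0" "eigenvalue (Dg1 A X) x"
    unfolding unstable_fixed_point_def by blast
  from this(2) have "eigenvalue (map_mat complex_of_real (Dg1 A X)) (complex_of_real x)"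
    by (rule of_real_hom.eigenvalue_hom [OF Dg1_index(1) [OF A X]])
  with assms \<open>x < 0\<close> show False by (fastforce simp: stable_fixed_point_def)
qed

section \<open>Simple eigenvalues and independence of the diagonalizer\<close>

lemma stable_form_cong:
  assumes V: "diagonalizer A V" and W: "diagonalizer A W"
    and simple: "\<And>j k. j < p \<Longrightarrow> k < n \<Longrightarrow> k \<noteq> j \<Longrightarrow> l k \<noteq> l j"
    and "stable_form A p V X"
  shows "stable_form A p W X"
proof -
  obtain s where s: "\<forall>j<p. s j \<in> {1, -1}"
    and XV: "\<forall>j<p. \<forall>a<n. column X j a = s j * sqrt (- l j) * column V j a"
    using assms(4) unfolding stable_form_iff [OF A diagonalizerD(1) [OF V] X pn] by blast
  have "\<exists>c\<in>{1, -1}. \<forall>a<n. column V j a = c * column W j a" if "j < p" for j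
    using eigenbasis_simple_eigenvalue [OF entry_symmetric diagonalizerD(2) [OF V] diagonalizerD(2) [OF W], of j]
      that pn simple by (metis order_less_le_trans)
  then obtain c where c: "\<And>j. j < p \<Longrightarrow> c j \<in> {1, -1} \<and> (\<forall>a<n. column V j a = c j * column W j a)"
    by metis
  show ?thesis
    unfolding stable_form_iff [OF A diagonalizerD(1) [OF W] X pn]
  proof (intro exI [of _ "\<lambda>j. s j * c j"] conjI allI impI)
    show "s j * c j \<in> {1, -1}" if "j < p" for j using s c [OF that] that by auto
    show "column X j a = s j * c j * sqrt (- l j) * column W j a" if "j < p" "a < n" for j a
      using XV c [OF that(1)] that by simp
  qed
qed

text \<open>The permutation may select any of the first \<open>q\<close> places, so simplicity is
  demanded for all of them and not just for the first \<open>p\<close>.\<close>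

lemma fixed_form_cong:
  assumes V: "diagonalizer A V" and W: "diagonalizer A W"
    and simple: "\<And>j k. j < q \<Longrightarrow> k < n \<Longrightarrow> k \<noteq> j \<Longrightarrow> l k \<noteq> l j"
    and "fixed_form A p V X"
  shows "fixed_form A p W X"
proof -
  obtain \<sigma> s where \<sigma>: "\<sigma> permutes {..<q}" and s: "\<forall>j<p. s j \<in> {0, 1, -1}"
    and XV: "\<forall>j<p. \<forall>a<n. column X j a = s j * sqrt (- l (\<sigma> j)) * column V (\<sigma> j) a"
    using assms(4) unfolding fixed_form_iff [OF A diagonalizerD(1) [OF V] X q p qn] by blast
  have \<sigma>q: "\<sigma> j < q" if "j < p" for j
    using permutes_in_image [OF \<sigma>, of j] that p by simp
  have "\<exists>c\<in>{1, -1}. \<forall>a<n. column V j a = c * column W j a" if "j < q" for j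
    using eigenbasis_simple_eigenvalue [OF entry_symmetric diagonalizerD(2) [OF V] diagonalizerD(2) [OF W], of j]
      that qn simple by (metis order_less_le_trans)
  then obtain c where c: "\<And>j. j < q \<Longrightarrow> c j \<in> {1, -1} \<and> (\<forall>a<n. column V j a = c j * column W j a)"
    by metis
  show ?thesis
    unfolding fixed_form_iff [OF A diagonalizerD(1) [OF W] X q p qn]
  proof (intro exI [of _ \<sigma>] exI [of _ "\<lambda>j. s j * c (\<sigma> j)"] conjI allI impI \<sigma>)
    show "s j * c (\<sigma> j) \<in> {0, 1, -1}" if "j < p" for j using s c [OF \<sigma>q [OF that]] that by auto
    show "column X j a = s j * c (\<sigma> j) * sqrt (- l (\<sigma> j)) * column W (\<sigma> j) a" if "j < p" "a < n" for j a
      using XV c [OF \<sigma>q [OF that(1)]] that by simp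
  qed
qed

text \<open>In a sorted list, strict steps between neighbours separate all pairs. The step from
  \<open>p - 1\<close> to \<open>p\<close>, present when \<open>p < n\<close>, separates the first
  \<open>p\<close> eigenvalues from the rest.\<close>

lemma simple_from_gaps:
  assumes gap: "\<And>i. i < p \<Longrightarrow> Suc i < n \<Longrightarrow> l i < l (Suc i)"
    and "j < p" "k < n" "k \<noteq> j"
  shows "l k \<noteq> l j"
proof (cases "k < j")
  case True
  then show ?thesis using gap [of k] l_mono [of "Suc k" j] assms(2) pn by simp
next
  case False
  then have "j < k" using \<open>k \<noteq> j\<close> by simp
  then have "l j < l (Suc j)" "l (Suc j) \<le> l k"
    using gap [of j] l_mono [of "Suc j" k] assms(2,3) by auto
  then show ?thesis by simp
qed

text \<open>If \<open>l k = l j\<close>, then \<open>V k\<close> is orthogonal to columns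
  \<open>0, ..., j\<close> of \<open>X\<close> and produces the Jacobian eigenvalue
  \<open>l k + d j = 0\<close>, which is not strictly positive.\<close>

lemma stable_imp_simple:
  assumes st: "stable_fixed_point \<alpha> A X" and V: "diagonalizer A V" and sf: "stable_form A p V X"
    and j: "j < p" and k: "j < k" "k < n"
  shows "l j < l k"
proof (rule ccontr)
  assume "\<not> l j < l k"
  with l_mono [of j k] k have eq: "l k = l j" by simp
  obtain s where s: "\<forall>j<p. s j \<in> {1, -1}"
    and XV: "\<forall>j<p. \<forall>a<n. column X j a = s j * sqrt (- l j) * column V j a"
    using sf unfolding stable_form_iff [OF A diagonalizerD(1) [OF V] X pn] by blast
  have VV: "ip n (column V i) (column V m) = (if i = m then 1 else 0)" if "i < n" "m < n" for i m
    using diagonalizerD(2) [OF V] that by (simp add: eigenbasis_def)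
  have XX: "ip n (column V m) (column X i) = (if m = i then s i * sqrt (- l i) else 0)" if "i < p" "m < n" for i m
  proof -
    have "ip n (column V m) (column X i) = ip n (column V m) (\<lambda>a. s i * sqrt (- l i) * column V i a)"
      by (rule ip_cong) (use XV that in auto)
    then show ?thesis using VV [of m i] that pn by (simp add: ip_linear)
  qed
  have "d j = ip n (\<lambda>a. s j * sqrt (- l j) * column V j a) (column X j)"
    by (rule ip_cong) (use XV j in auto)
  also have "\<dots> = - l j"
    unfolding ip_linear using XX [of j j] s j pn l_neg [of j] p qn by auto
  finally have dj: "d j = - l j" .
  have "eigenvalue (map_mat complex_of_real (Dg1 A X)) (of_real (l k + d j))"
  proof (rule eigenvalue_of_eigenvector [of _ "column V k"])
    show "fixed_point \<alpha> A X" using st by (simp add: stable_fixed_point_def)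
    show "\<exists>a<n. column V k a \<noteq> 0" using VV [OF k(2,2)] ip_self_eq_0_iff [of n "column V k"] by auto
    show "ip n (column V k) (column X i) = 0" if "i \<le> j" for i
      using XX [of i k] that j k by simp
    show "mv n (entry A) (column V k) a = l k * column V k a" if "a < n" for a
      using diagonalizerD(2) [OF V] k that by (simp add: eigenbasis_def)
  qed (use j eq dj in simp_all)
  with st show False unfolding stable_fixed_point_def by (auto simp: eq dj)
qed

text \<open>Stability excludes instability and so provides some diagonalizer. It also forces the
  simplicity that permits exchanging this diagonalizer for the given \<open>U\<close>.\<close>

lemma stable_imp_stable_form:
  assumes st: "stable_fixed_point \<alpha> A X"
  shows "stable_form A p U X"
proof -
  obtain V where V: "diagonalizer A V" and sf: "stable_form A p V X"
    using not_unstable_imp_stable_form stable_imp_not_unstable [OF st] st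
    unfolding stable_fixed_point_def by blast
  show ?thesis
  proof (rule stable_form_cong [OF V U _ sf])
    fix j k assume "j < p" "k < n" "k \<noteq> j"
    then show "l k \<noteq> l j"
      by (rule simple_from_gaps [rotated]) (rule stable_imp_simple [OF st V sf _ lessI])
  qed
qed

text \<open>The gaps make \<open>l k - l j\<close> strictly positive for \<open>j < k\<close>. The
  case list applies to complex eigenvalues as well and contains only real values, so the spectrum is
  real.\<close>

lemma stable_form_imp_stable:
  assumes sf: "stable_form A p U X"
    and gap: "\<And>i. i < p \<Longrightarrow> Suc i < n \<Longrightarrow> l i < l (Suc i)"
  shows "stable_fixed_point \<alpha> A X"
  unfolding stable_fixed_point_def
proof (intro conjI allI impI)
  show "fixed_point \<alpha> A X"
    using fixed_form_imp_fixed_point [OF U stable_form_imp_fixed_form [OF U sf]] .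
  fix z assume "eigenvalue (map_mat complex_of_real (Dg1 A X)) z"
  then obtain j k where jk: "j < p" "k < n"
    and z: "z = of_real (if k < j then - l j else if k = j then - 2 * l j else l k - l j)"
    by (rule stable_form_eigenvalue_cases [OF U sf])
  have "l j < 0" using l_neg [of j] jk(1) p qn by simp
  moreover have "l j < l k" if "j < k"
    using gap [of j] l_mono [of "Suc j" k] that jk by simp
  ultimately show "z \<in> \<real>" "0 < Re z" unfolding z by auto
qed

lemma fixed_point_iff_fixed_form:
  assumes "distinct (filter (\<lambda>x. x < 0) (eigs A))"
  shows "fixed_point \<alpha> A X \<longleftrightarrow> fixed_form A p U X"
proof
  have "l k \<noteq> l j" if "j < q" "k < n" "k \<noteq> j" for j k
    using distinct_filter_nth [OF assms, of j k] that qn length_eigs_n l_neg [of j] by auto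
  then show "fixed_form A p U X" if "fixed_point \<alpha> A X"
    using fixed_point_imp_fixed_form [OF that] fixed_form_cong [OF _ U] by blast
qed (rule fixed_form_imp_fixed_point [OF U])

end

text \<open>The first three clauses hold with arbitrary multiplicities. There the diagonalizer is
  quantified where the adapted basis depends on \<open>X\<close>, and stability gives one
  implication only, because a tie puts 0 into the spectrum. The last two clauses fix
  \<open>U\<close> throughout: simple negative eigenvalues suffice for the fixed points, and gaps
  after each of the first \<open>p\<close> eigenvalues suffice for the stability dichotomy.\<close>

theorem theorem3p1:
  fixes A U X :: "real mat" and n p q :: nat and \<alpha> :: real
  assumes A: "A \<in> carrier_mat n n" and sym: "A\<^sup>T = A"
    and q: "q = num_neg_eigs A" and p: "p \<le> q"
    and \<alpha>: "\<alpha> > 0"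
    and U: "diagonalizer A U"
    and X: "X \<in> carrier_mat n p"
  shows
    "(fixed_point \<alpha> A X \<longleftrightarrow> (\<exists>V. diagonalizer A V \<and> fixed_form A p V X)) \<and>
     (stable_fixed_point \<alpha> A X \<longrightarrow> stable_form A p U X) \<and>
     (unstable_fixed_point \<alpha> A X \<longleftrightarrow>
        fixed_point \<alpha> A X \<and> \<not> (\<exists>V. diagonalizer A V \<and> stable_form A p V X)) \<and>
     (distinct (filter (\<lambda>x. x < 0) (eigs A)) \<longrightarrow>
        (fixed_point \<alpha> A X \<longleftrightarrow> fixed_form A p U X)) \<and>
     ((\<forall>i<p. Suc i < n \<longrightarrow> eigs A ! i < eigs A ! Suc i) \<longrightarrow>
        (stable_fixed_point \<alpha> A X \<longleftrightarrow> stable_form A p U X) \<and>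
        (unstable_fixed_point \<alpha> A X \<longleftrightarrow> fixed_point \<alpha> A X \<and> \<not> stable_form A p U X))"
proof -
  interpret symmetric_iteration A U X n p q \<alpha>
    by unfold_locales (rule A sym q p \<alpha> U X)+
  \<comment> \<open>Under the gap hypothesis \<open>stable_form\<close> does not depend on the
    diagonalizer, so the existential in the general criterion for instability collapses to
    \<open>U\<close>.\<close>
  have simple: "stable_form A p V X \<longleftrightarrow> stable_form A p U X"
    if "\<forall>i<p. Suc i < n \<longrightarrow> eigs A ! i < eigs A ! Suc i" "diagonalizer A V" for V
    using stable_form_cong [OF that(2) U] stable_form_cong [OF U that(2)]
      simple_from_gaps that(1) by blast
  show ?thesis
  proof (intro conjI impI)
    show "fixed_point \<alpha> A X \<longleftrightarrow> (\<exists>V. diagonalizer A V \<and> fixed_form A p V X)"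
      using fixed_form_imp_fixed_point fixed_point_imp_fixed_form by blast
    show "stable_form A p U X" if "stable_fixed_point \<alpha> A X"
      using stable_imp_stable_form [OF that] .
    show "unstable_fixed_point \<alpha> A X \<longleftrightarrow>
        fixed_point \<alpha> A X \<and> \<not> (\<exists>V. diagonalizer A V \<and> stable_form A p V X)"
      by (rule unstable_iff)
    show "fixed_point \<alpha> A X \<longleftrightarrow> fixed_form A p U X" if "distinct (filter (\<lambda>x. x < 0) (eigs A))"
      using fixed_point_iff_fixed_form [OF that] .
    assume gap: "\<forall>i<p. Suc i < n \<longrightarrow> eigs A ! i < eigs A ! Suc i"
    show "stable_fixed_point \<alpha> A X \<longleftrightarrow> stable_form A p U X"
      using stable_imp_stable_form stable_form_imp_stable gap by blast
    show "unstable_fixed_point \<alpha> A X \<longleftrightarrow> fixed_point \<alpha> A X \<and> \<not> stable_form A p U X"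
      unfolding unstable_iff using simple [OF gap] U by blast
  qed
qed

end
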